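(* For every fixed $t\in\mathbb{N}$ there is a constant $C_t$ (depending only on $t$) and a 1-sided error, nonadaptive, $t$-online-erasure-resilient $\varepsilon$-tester for quadraticity of functions $f:\{0,1\}^d\to\{0,1\}$ (for all $\varepsilon\in(0,1)$ and all $d$ sufficiently large in terms of $t$ and $\varepsilon$) that makes at most $C_t/\varepsilon$ queries, i.e., $O(1/\varepsilon)$ queries for constant $t$.
   Context: Online-erasure model. An input is a function $f:D\to R$ on a finite domain $D$. An algorithm accesses $f$ only through an oracle $\mathcal{O}$ by querying points $x\in D$ one at a time and receiving $\mathcal{O}(x)$. Initially $\mathcal{O}(x)=f(x)$ for all $x\in D$. For $t\in\mathbb{N}$, a $t$-online-erasure oracle, after answering each query, may choose up to $t$ points $x\in D$ and set $\mathcal{O}(x)=\perp$ (a special "erased" symbol); these values are used to answer all future queries. The choice of erasures (the adversarial strategy) may depend on $f$, on the queries and answers so far, and on the algorithm's code, but not on the algorithm's future random coins; the algorithm does not know where erasures are. A property $\mathcal{P}$ is a set of functions; $f$ is $\varepsilon$-far from $\mathcal{P}$ if for every $g\in\mathcal{P}$, $f$ and $g$ differ on at least an $\varepsilon$ fraction of $D$. A $t$-online-erasure-resilient $\varepsilon$-tester for $\mathcal{P}$ is a randomized algorithm that, given $t,\varepsilon$ and access to $f$ via a $t$-online-erasure oracle, for every adversarial strategy accepts with probability at least $2/3$ if $f\in\mathcal{P}$ and rejects with probability at least $2/3$ if $f$ is $\varepsilon$-far from $\mathcal{P}$. It has 1-sided error if it accepts every $f\in\mathcal{P}$ with probability 1;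 it is nonadaptive if its queries do not depend on answers to previous queries. A function $f:\{0,1\}^d\to\{0,1\}$ is quadratic if it can be written (over $\mathbb{F}_2$) as a sum of monomials of the form $x[i]$ or $x[i]x[j]$, $i,j\in[d]$. *)

theory Defs
  imports "HOL-Probability.Probability"
begin

definition cube :: "nat \<Rightarrow> bool list set" where
  "cube d = {x. length x = d}"

text \<open>Quadratic functions over F_2: sums of monomials x[i] and x[i]x[j] (i, j < d).
  Only the values on the cube matter.\<close>
definition quadratic :: "nat \<Rightarrow> (bool list \<Rightarrow> bool) \<Rightarrow> bool" where
  "quadratic d g \<longleftrightarrow> (\<exists>(a :: nat \<Rightarrow> bool) (b :: nat \<Rightarrow> nat \<Rightarrow> bool). \<forall>x \<in> cube d.
      g x = odd (card {i. i < d \<and> a i \<and> x ! i}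
               + card {(i, j). i < d \<and> j < d \<and> b i j \<and> x ! i \<and> x ! j}))"

definition far_from_quadratic :: "nat \<Rightarrow> real \<Rightarrow> (bool list \<Rightarrow> bool) \<Rightarrow> bool" where
  "far_from_quadratic d eps f \<longleftrightarrow>
     (\<forall>g. quadratic d g \<longrightarrow> real (card {x \<in> cube d. f x \<noteq> g x}) \<ge> eps * 2 ^ d)"

text \<open>An adversary (deterministic erasure strategy) maps the transcript so far
  (queries with the answers given; None = erased symbol) to the set of points it erases
  after answering the last query.  A t-online-erasure adversary erases at most t
  points of the domain each time.\<close>
type_synonym adversary = "(bool list \<times> bool option) list \<Rightarrow> bool list set"

definition valid_adversary :: "nat \<Rightarrow> nat \<Rightarrow> adversary \<Rightarrow> bool" where
  "valid_adversary d t A \<longleftrightarrow> (\<forall>h. A h \<subseteq> cube d \<and> finite (A h) \<and> card (A h) \<le> t)"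

fun run_aux :: "(bool list \<Rightarrow> bool) \<Rightarrow> adversary \<Rightarrow> bool list set \<Rightarrow>
    (bool list \<times> bool option) list \<Rightarrow> bool list list \<Rightarrow> (bool list \<times> bool option) list" where
  "run_aux f A E h [] = h"
| "run_aux f A E h (x # xs) =
     (let a = (if x \<in> E then None else Some (f x)); h' = h @ [(x, a)]
      in run_aux f A (E \<union> A h') h' xs)"

definition oracle_answers :: "(bool list \<Rightarrow> bool) \<Rightarrow> adversary \<Rightarrow> bool list list \<Rightarrow> bool option list" where
  "oracle_answers f A qs = map snd (run_aux f A {} [] qs)"

text \<open>A nonadaptive randomized tester: a distribution over its random coins, each
  determining the query sequence (fixed in advance) and the decision rule
  (True = accept) applied to the sequence of answers.\<close>
type_synonym tester = "(bool list list \<times> (bool option list \<Rightarrow> bool)) pmf"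

definition accept_prob :: "tester \<Rightarrow> (bool list \<Rightarrow> bool) \<Rightarrow> adversary \<Rightarrow> real" where
  "accept_prob T f A = measure_pmf.prob T {(qs, dec). dec (oracle_answers f A qs)}"

definition online_erasure_quadratic_tester ::
    "nat \<Rightarrow> nat \<Rightarrow> real \<Rightarrow> real \<Rightarrow> tester \<Rightarrow> bool" where
  "online_erasure_quadratic_tester t d eps q T \<longleftrightarrow>
     (\<forall>(qs, dec) \<in> set_pmf T. set qs \<subseteq> cube d \<and> real (length qs) \<le> q)
   \<and> (\<forall>f A. quadratic d f \<longrightarrow> valid_adversary d t A \<longrightarrow> accept_prob T f A = 1)
   \<and> (\<forall>f A. far_from_quadratic d eps f \<longrightarrow> valid_adversary d t A \<longrightarrow>
            1 - accept_prob T f A \<ge> 2 / 3)"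

end

theory Submission
  imports Defs "HOL-Library.Z2" "HOL-Library.Function_Algebras" "HOL-Real_Asymp.Real_Asymp"
begin

text \<open>
  A function f that is far from quadratic violates the identity "the sum of g over the nonzero
  points of a random span(x, y, z) vanishes" with probability \<open>\<eta> \<ge> eps / 34\<close>: for smaller \<open>\<eta>\<close> the
  majority votes of the identity define a quadratic g that is close to f (the self-correction
  argument of Alon, Kaufman, Krivelevich, Litsyn and Ron).

  The tester picks three random linear maps X, Y, Z from a space of dimension
  \<open>k = 2 log N + O(t)\<close> and queries \<open>N = O(1 / eps)\<close> random points, each a random nonempty partial
  sum of X u, Y u, Z u for a random nonzero u. It accepts iff some quadratic function agrees with all
  answers that were not erased, so it has 1-sided error.
  Since \<open>2 ^ k\<close> is much larger than \<open>t * N\<^sup>2\<close>, an adversary that even knows X, Y, Z erases a future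
  query only with small probability. The triples (X u, Y u, Z u) are pairwise independent, hence by
  Chebyshev's inequality about a fraction \<open>\<eta>\<close> of them is violated, and every quadratic function disagrees
  with f on a fraction of at least \<open>\<eta> / 14\<close> of the sample space. A union bound over all quadratic
  functions with this bound alone would cost an extra factor \<open>k\<^sup>2\<close> in N; but two quadratic functions
  differ on a constant fraction of the sample space, so all but one of them disagree with f on a constant
  fraction, and \<open>N = O(1 / eps)\<close> suffices.
\<close>

section \<open>Self-correction for the seven-point identity\<close>

text \<open>Sums and products of bits stay in ring form, so that the laws of commutative groups and
  rings simplify them.\<close>

declare add_bit_eq_xor [simp del] mult_bit_eq_and [simp del]

text \<open>Together with \<open>ac_simps\<close>, the rules \<open>add_self\<close> and
  \<open>add_self_left\<close> cancel equal summands in pairs. This normalisation proves most of the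
  identities below.\<close>

class boolean_group = ab_group_add +
  assumes add_self [simp]: "x + x = 0"
begin

lemma add_self_left [simp]: "x + (x + y) = y"
  by (simp flip: add.assoc)

lemma add_eq_0_iff_eq: "x + y = 0 \<longleftrightarrow> x = y"
  by (metis add.assoc add_0_right add_self)

end

instance bit :: boolean_group
  by standard (metis add.right_inverse uminus_bit_def id_apply)

instance "fun" :: (type, boolean_group) boolean_group
  by standard (auto simp: fun_eq_iff)

instance prod :: (boolean_group, boolean_group) boolean_group
  by standard (auto simp: prod_eq_iff)

abbreviation triples :: "'a set \<Rightarrow> ('a \<times> 'a \<times> 'a) set" where
  "triples V \<equiv> V \<times> V \<times> V"

text \<open>A set instead of a type, because the dimension varies: spaces of all dimensions live
  inside one function type.\<close>

definition finite_subgroup :: "'a::boolean_group set \<Rightarrow> bool" where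
  "finite_subgroup V \<longleftrightarrow> finite V \<and> 0 \<in> V \<and> (\<forall>x\<in>V. \<forall>y\<in>V. x + y \<in> V)"

lemma finite_subgroupD:
  assumes "finite_subgroup V"
  shows "finite V" "0 \<in> V" "x \<in> V \<Longrightarrow> y \<in> V \<Longrightarrow> x + y \<in> V" "card V > 0"
  using assms by (auto simp: finite_subgroup_def card_gt_0_iff)

lemma finite_subgroup_Times:
  "finite_subgroup A \<Longrightarrow> finite_subgroup B \<Longrightarrow> finite_subgroup (A \<times> B)"
  by (auto simp: finite_subgroup_def zero_prod_def)

lemma sum_translate:
  assumes "finite_subgroup V" "a \<in> V"
  shows "(\<Sum>x\<in>V. \<phi> (a + x)) = (\<Sum>x\<in>V. \<phi> x)"
  by (rule sum.reindex_bij_witness[where i = "\<lambda>x. a + x" and j = "\<lambda>x. a + x"])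
    (use assms in \<open>auto simp: finite_subgroup_def\<close>)

text \<open>All fibres of a surjective homomorphism have the same size, so the image of a uniform
  element is uniform. Here and later, probabilities are written as sums over the sample space with
  the denominators multiplied out.\<close>

lemma hom_uniform:
  fixes D :: "'a::boolean_group \<Rightarrow> 'b::boolean_group" and \<phi> :: "'b \<Rightarrow> real"
  assumes W: "finite_subgroup W" and V: "finite_subgroup V"
    and add: "\<And>x y. x \<in> W \<Longrightarrow> y \<in> W \<Longrightarrow> D (x + y) = D x + D y"
    and im: "D ` W = V"
  shows "real (card V) * (\<Sum>w\<in>W. \<phi> (D w)) = real (card W) * (\<Sum>v\<in>V. \<phi> v)"
proof -
  have shift: "(\<Sum>w\<in>W. \<phi> (v + D w)) = (\<Sum>w\<in>W. \<phi> (D w))" if "v \<in> V" for v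
  proof -
    have "v \<in> D ` W" using that im by simp
    then obtain x where x: "x \<in> W" "v = D x" by blast
    have "(\<Sum>w\<in>W. \<phi> (v + D w)) = (\<Sum>w\<in>W. \<phi> (D (x + w)))"
      using x add by (intro sum.cong) auto
    also have "\<dots> = (\<Sum>w\<in>W. \<phi> (D w))"
      using sum_translate[OF W x(1), of "\<lambda>w. \<phi> (D w)"] .
    finally show ?thesis .
  qed
  have "real (card V) * (\<Sum>w\<in>W. \<phi> (D w)) = (\<Sum>v\<in>V. \<Sum>w\<in>W. \<phi> (v + D w))"
    using shift by simp
  also have "\<dots> = (\<Sum>w\<in>W. \<Sum>v\<in>V. \<phi> (D w + v))"
    by (subst sum.swap) (simp add: add.commute)
  also have "\<dots> = (\<Sum>w\<in>W. \<Sum>v\<in>V. \<phi> v)"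
    using im by (intro sum.cong refl sum_translate[OF V]) auto
  finally show ?thesis by simp
qed

section \<open>Nonempty partial sums of a triple and the seven-point sum\<close>

definition select :: "bool \<times> bool \<times> bool \<Rightarrow> 'a::boolean_group \<times> 'a \<times> 'a \<Rightarrow> 'a" where
  "select s p = (if fst s then fst p else 0) + (if fst (snd s) then fst (snd p) else 0)
     + (if snd (snd s) then snd (snd p) else 0)"

definition selectors :: "(bool \<times> bool \<times> bool) set" where
  "selectors = UNIV - {(False, False, False)}"

lemma selectors_eq: "selectors = {(True,False,False), (False,True,False), (False,False,True),
   (True,True,False), (True,False,True), (False,True,True), (True,True,True)}"
  by (auto simp: selectors_def)

lemma card_selectors: "card selectors = 7" and finite_selectors: "finite selectors"
  by (simp_all add: selectors_eq)

lemma select_add: "select s (p + q) = select s p + select s q"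
  by (auto simp: select_def ac_simps)

lemma select_mem:
  "finite_subgroup V \<Longrightarrow> p \<in> triples V \<Longrightarrow> select s p \<in> V"
  by (auto simp: select_def finite_subgroup_def)

lemma select_surj:
  assumes V: "finite_subgroup V" and s: "s \<in> selectors"
  shows "select s ` (triples V) = V"
proof
  show "select s ` (triples V) \<subseteq> V" using select_mem[OF V] by blast
  show "V \<subseteq> select s ` (triples V)"
  proof
    fix v assume v: "v \<in> V"
    have "\<exists>p \<in> {(v,0,0), (0,v,0), (0,0,v)}. v = select s p"
      using s by (auto simp: selectors_eq select_def)
    then show "v \<in> select s ` (triples V)"
      using v finite_subgroupD(2)[OF V] by blast
  qed
qed

definition seven_sum :: "('a::boolean_group \<Rightarrow> bit) \<Rightarrow> 'a \<times> 'a \<times> 'a \<Rightarrow> bit" where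
  "seven_sum F p = (\<Sum>s\<in>selectors. F (select s p))"

lemma seven_sum_eq: "seven_sum F (x, y, z) =
    F x + F y + F z + F (x + y) + F (x + z) + F (y + z) + F (x + y + z)"
  by (simp add: seven_sum_def selectors_eq select_def ac_simps)

section \<open>Violated triples and votes for the value at a point\<close>

abbreviation (input) violations :: "'a::boolean_group set \<Rightarrow> ('a \<Rightarrow> bit) \<Rightarrow> real" where
  "violations V F \<equiv> (\<Sum>p\<in>triples V. of_bool (seven_sum F p \<noteq> 0))"

text \<open>The value at \<open>a\<close> that the seven-point identity for \<open>(a, y, z)\<close>
  predicts from the other six points.\<close>

definition vote :: "('a::boolean_group \<Rightarrow> bit) \<Rightarrow> 'a \<Rightarrow> 'a \<Rightarrow> 'a \<Rightarrow> bit" where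
  "vote F a y z = F y + F z + F (a + y) + F (a + z) + F (y + z) + F (a + y + z)"

lemma vote_commute: "vote F a y z = vote F a z y"
  by (simp add: vote_def ac_simps)

lemma seven_sum_vote: "seven_sum F (a, y, z) = F a + vote F a y z"
  by (simp add: seven_sum_eq vote_def ac_simps)

text \<open>The votes of (y, z) and (y', z) differ by the sum of F over the affine 3-flat through y with
  directions a, z and y + y'; splitting the step a at the origin turns it into two seven-point sums.\<close>
lemma vote_diff:
  "vote F a y z + vote F a y' z = seven_sum F (y, z, y + y') + seven_sum F (a + y, z, y + y')"
proof -
  have "a + y + (y + y') = a + y'" "a + y + z + (y + y') = a + y' + z" "y + z + (y + y') = y' + z"
    by (simp_all add: ac_simps)
  then show ?thesis
    by (simp add: vote_def seven_sum_eq ac_simps)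
qed

lemma sum_triple: "(\<Sum>p\<in>A \<times> B \<times> C. \<phi> p) = (\<Sum>x\<in>A. \<Sum>y\<in>B. \<Sum>z\<in>C. \<phi> (x, y, z))"
  by (simp add: sum.cartesian_product case_prod_beta)

text \<open>By \<open>vote_diff\<close>, two votes that share \<open>z\<close> differ only if one of
  two identities fails. Substituting \<open>w = y + y'\<close> and translating by \<open>a\<close>
  turns each of them into the identity for a uniform triple.\<close>

lemma vote_collision:
  assumes V: "finite_subgroup V" and a: "a \<in> V"
  shows "(\<Sum>y\<in>V. \<Sum>z\<in>V. \<Sum>y'\<in>V. of_bool (vote F a y z \<noteq> vote F a y' z)) \<le> 2 * violations V F"
proof -
  let ?\<chi> = "\<lambda>p. of_bool (seven_sum F p \<noteq> 0) :: real"
  have "(\<Sum>y\<in>V. \<Sum>z\<in>V. \<Sum>y'\<in>V. of_bool (vote F a y z \<noteq> vote F a y' z) :: real)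
      \<le> (\<Sum>y\<in>V. \<Sum>z\<in>V. \<Sum>y'\<in>V. ?\<chi> (y, z, y + y') + ?\<chi> (a + y, z, y + y'))"
  proof (intro sum_mono)
    fix y z y'
    show "of_bool (vote F a y z \<noteq> vote F a y' z) \<le> ?\<chi> (y, z, y + y') + ?\<chi> (a + y, z, y + y')"
      using vote_diff[of F a y z y'] add_eq_0_iff_eq[of "vote F a y z" "vote F a y' z"]
      by (auto simp del: bit_not_zero_iff bit_not_one_iff)
  qed
  also have "\<dots> = (\<Sum>y\<in>V. \<Sum>z\<in>V. \<Sum>w\<in>V. ?\<chi> (y, z, w) + ?\<chi> (a + y, z, w))"
  proof (rule sum.cong[OF refl], rule sum.cong[OF refl])
    fix y z assume "y \<in> V"
    then show "(\<Sum>y'\<in>V. ?\<chi> (y, z, y + y') + ?\<chi> (a + y, z, y + y'))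
        = (\<Sum>w\<in>V. ?\<chi> (y, z, w) + ?\<chi> (a + y, z, w))"
      by (rule sum_translate[OF V, of _ "\<lambda>w. ?\<chi> (y, z, w) + ?\<chi> (a + y, z, w)"])
  qed
  also have "\<dots> = (\<Sum>y\<in>V. \<Sum>z\<in>V. \<Sum>w\<in>V. ?\<chi> (y, z, w)) + (\<Sum>y\<in>V. \<Sum>z\<in>V. \<Sum>w\<in>V. ?\<chi> (a + y, z, w))"
    by (simp add: sum.distrib)
  also have "\<dots> = 2 * violations V F"
    using sum_translate[OF V a, of "\<lambda>y. \<Sum>z\<in>V. \<Sum>w\<in>V. ?\<chi> (y, z, w)"] by (simp add: sum_triple)
  finally show ?thesis .
qed

text \<open>Let \<eta> be the fraction of violated triples. Two independent votes are compared
  through the mixed pair \<open>(y', z)\<close>, so they differ with probability at most 4 \<eta>.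
  This probability is twice the product of the two vote frequencies. The larger frequency is at
  least 1/2, so the smaller one is at most 4 \<eta>.\<close>

lemma vote_majority:
  assumes V: "finite_subgroup V" and a: "a \<in> V"
  shows "\<exists>c. real (card V) * (\<Sum>y\<in>V. \<Sum>z\<in>V. of_bool (vote F a y z \<noteq> c)) \<le> 4 * violations V F"
proof -
  let ?R = "violations V F"
  let ?v = "\<lambda>q. vote F a (fst q) (snd q)"
  define n where "n = real (card V)"
  have n: "n > 0" using finite_subgroupD(4)[OF V] by (simp add: n_def)
  define p where "p c = (\<Sum>q\<in>V \<times> V. of_bool (?v q \<noteq> c) :: real)" for c
  have p_eq: "p c = (\<Sum>y\<in>V. \<Sum>z\<in>V. of_bool (vote F a y z \<noteq> c))" for c
    by (simp add: p_def sum.cartesian_product case_prod_beta)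
  have p0: "p c \<ge> 0" for c unfolding p_def by (intro sum_nonneg) auto
  have "p 0 + p 1 = (\<Sum>q\<in>V \<times> V. of_bool (?v q \<noteq> 0) + of_bool (?v q \<noteq> 1))"
    by (simp add: p_def sum.distrib)
  also have "\<dots> = (\<Sum>q\<in>V \<times> V. 1)"
    by (intro sum.cong) auto
  finally have tot: "p 0 + p 1 = n\<^sup>2" by (simp add: n_def card_cartesian_product power2_eq_square)
  \<comment> \<open>For bits, \<open>p 0\<close> counts the votes 1 and \<open>p 1\<close> the votes
    0. Each disagreeing pair occurs in both orders, hence the factor 2.\<close>
  have "2 * p 0 * p 1 = (\<Sum>q\<in>V \<times> V. \<Sum>r\<in>V \<times> V. of_bool (?v q \<noteq> ?v r))"
  proof -
    have "(\<Sum>q\<in>V \<times> V. \<Sum>r\<in>V \<times> V. of_bool (?v q \<noteq> ?v r)) = (\<Sum>q\<in>V \<times> V. \<Sum>r\<in>V \<times> V.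
        of_bool (?v q \<noteq> 0) * of_bool (?v r \<noteq> 1) + of_bool (?v q \<noteq> 1) * of_bool (?v r \<noteq> 0) :: real)"
      by (intro sum.cong refl) (auto simp: of_bool_def)
    also have "\<dots> = p 0 * p 1 + p 1 * p 0"
      by (simp add: p_def sum.distrib sum_product)
    finally show ?thesis by simp
  qed
  also have "\<dots> \<le> (\<Sum>q\<in>V \<times> V. \<Sum>r\<in>V \<times> V. of_bool (vote F a (fst q) (snd q) \<noteq> vote F a (fst r) (snd q))
       + of_bool (vote F a (fst r) (snd q) \<noteq> vote F a (fst r) (snd r)))"
    by (intro sum_mono) auto
  also have "\<dots> = n * (\<Sum>y\<in>V. \<Sum>z\<in>V. \<Sum>y'\<in>V. of_bool (vote F a y z \<noteq> vote F a y' z))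
       + n * (\<Sum>y'\<in>V. \<Sum>z\<in>V. \<Sum>z'\<in>V. of_bool (vote F a y' z \<noteq> vote F a y' z'))"
  proof -
    have "(\<Sum>q\<in>V \<times> V. \<Sum>r\<in>V \<times> V. of_bool (vote F a (fst q) (snd q) \<noteq> vote F a (fst r) (snd q)))
       = (\<Sum>y\<in>V. \<Sum>z\<in>V. \<Sum>y'\<in>V. n * of_bool (vote F a y z \<noteq> vote F a y' z))"
      by (simp add: n_def sum.cartesian_product' case_prod_beta)
    moreover have "(\<Sum>q\<in>V \<times> V. \<Sum>r\<in>V \<times> V. of_bool (vote F a (fst r) (snd q) \<noteq> vote F a (fst r) (snd r)))
       = n * (\<Sum>y'\<in>V. \<Sum>z\<in>V. \<Sum>z'\<in>V. of_bool (vote F a y' z \<noteq> vote F a y' z'))"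
      by (subst sum.swap) (simp add: n_def sum.cartesian_product' case_prod_beta sum_distrib_left sum_distrib_right mult.commute)
    ultimately show ?thesis
      by (simp add: sum.distrib sum_distrib_left)
  qed
  also have "\<dots> \<le> n * (2 * ?R) + n * (2 * ?R)"
  proof (intro add_mono mult_left_mono vote_collision[OF V a])
    have "(\<Sum>y'\<in>V. \<Sum>z\<in>V. \<Sum>z'\<in>V. of_bool (vote F a y' z \<noteq> vote F a y' z'))
        = (\<Sum>z\<in>V. \<Sum>y'\<in>V. \<Sum>z'\<in>V. of_bool (vote F a z y' \<noteq> vote F a z' y') :: real)"
      by (subst sum.swap) (simp only: vote_commute)
    also have "\<dots> \<le> 2 * ?R" by (rule vote_collision[OF V a])
    finally show "(\<Sum>y'\<in>V. \<Sum>z\<in>V. \<Sum>z'\<in>V. of_bool (vote F a y' z \<noteq> vote F a y' z')) \<le> 2 * ?R" .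
  qed (use n in auto)
  finally have pq: "p 0 * p 1 \<le> 2 * n * ?R" by (simp add: mult_ac)
  have key: "n * x \<le> 4 * ?R" if "x * y \<le> 2 * n * ?R" "x + y = n\<^sup>2" "x \<le> y" "x \<ge> 0" for x y
  proof -
    have "n * (n * x) = (x + y) * x" using that by (simp add: power2_eq_square)
    also have "\<dots> \<le> (2 * y) * x" using that by (intro mult_right_mono) auto
    also have "\<dots> \<le> n * (4 * ?R)" using that(1) by (simp add: algebra_simps)
    finally show ?thesis using n by (rule mult_left_le_imp_le)
  qed
  have "n * p 0 \<le> 4 * ?R \<or> n * p 1 \<le> 4 * ?R"
  proof (cases "p 0 \<le> p 1")
    case True
    then show ?thesis using key[of "p 0" "p 1"] pq tot p0 by simp
  next
    case False
    then show ?thesis using key[of "p 1" "p 0"] pq tot p0 by (simp add: mult.commute add.commute)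
  qed
  then show ?thesis unfolding p_eq n_def by blast
qed

text \<open>Exchanges the order of summation: for each of the six arguments inside
  \<open>vote\<close>, additivity of \<open>select s\<close> collects the seven values into one
  seven-point sum.\<close>

lemma sum_vote_select:
  "(\<Sum>s\<in>selectors. vote F (select s A) (select s Y) (select s Z)) =
     seven_sum F Y + seven_sum F Z + seven_sum F (A + Y) + seven_sum F (A + Z)
       + seven_sum F (Y + Z) + seven_sum F (A + Y + Z)"
  by (simp add: vote_def seven_sum_def select_add sum.distrib)

lemma sum_triple_select:
  fixes \<phi> :: "'a::boolean_group \<Rightarrow> real"
  assumes V: "finite_subgroup V" and s: "s \<in> selectors"
  shows "(\<Sum>p\<in>triples V. \<phi> (select s p)) = (real (card V))\<^sup>2 * (\<Sum>v\<in>V. \<phi> v)"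
proof -
  have "real (card V) * (\<Sum>p\<in>triples V. \<phi> (select s p)) = real (card (triples V)) * (\<Sum>v\<in>V. \<phi> v)"
    by (intro hom_uniform) (auto intro!: finite_subgroup_Times V select_add simp: select_surj[OF V s])
  then show ?thesis
    using finite_subgroupD(4)[OF V] by (simp add: card_cartesian_product power2_eq_square)
qed

text \<open>\<open>G\<close> is the majority vote. For random \<open>Y\<close> and \<open>Z\<close>,
  each of the seven votes at the partial sums of \<open>A\<close> misses \<open>G\<close> with
  probability at most 4 \<eta>, and each of the six identities in \<open>sum_vote_select\<close>
  fails with probability \<eta>. As 34 = 7 * 4 + 6 and 34 \<eta> < 1, some \<open>Y\<close> and
  \<open>Z\<close> avoid all these events, and then the seven-point sum of \<open>G\<close> at
  \<open>A\<close> is zero.\<close>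

lemma self_correction:
  fixes F :: "'a::boolean_group \<Rightarrow> bit"
  assumes V: "finite_subgroup V" and small: "34 * violations V F < real (card V) ^ 3"
  obtains G where "\<And>p. p \<in> triples V \<Longrightarrow> seven_sum G p = 0"
    and "(real (card V))\<^sup>2 * real (card {x \<in> V. F x \<noteq> G x}) \<le> 2 * violations V F"
proof -
  let ?R = "violations V F"
  define n where "n = real (card V)"
  have n: "n > 0" using finite_subgroupD(4)[OF V] by (simp add: n_def)
  have R0: "?R \<ge> 0" by (intro sum_nonneg) auto
  have "\<forall>a\<in>V. \<exists>c. n * (\<Sum>y\<in>V. \<Sum>z\<in>V. of_bool (vote F a y z \<noteq> c)) \<le> 4 * ?R"
    using vote_majority[OF V] unfolding n_def by blast
  from bchoice[OF this] obtain G
    where G: "\<And>a. a \<in> V \<Longrightarrow> n * (\<Sum>y\<in>V. \<Sum>z\<in>V. of_bool (vote F a y z \<noteq> G a)) \<le> 4 * ?R"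
    by blast
  let ?V3 = "triples V"
  have V3: "finite_subgroup ?V3" by (intro finite_subgroup_Times V)
  let ?\<chi> = "\<lambda>p. of_bool (seven_sum F p \<noteq> 0) :: real"
  have cardV3: "real (card ?V3) = n ^ 3"
    by (simp add: n_def card_cartesian_product power3_eq_cube)
  show ?thesis
  proof (rule that)
    fix A assume A: "A \<in> ?V3"
    show "seven_sum G A = 0"
    proof (rule ccontr)
      assume ne: "seven_sum G A \<noteq> 0"
      let ?err = "\<lambda>s Y Z. of_bool (vote F (select s A) (select s Y) (select s Z) \<noteq> G (select s A)) :: real"
      let ?six = "\<lambda>Y Z. ?\<chi> Y + ?\<chi> Z + ?\<chi> (A + Y) + ?\<chi> (A + Z) + ?\<chi> (Y + Z) + ?\<chi> (A + Y + Z)"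
      \<comment> \<open>If the sum of \<open>G\<close> were nonzero, every choice of
        \<open>Y\<close> and \<open>Z\<close> would exhibit one of the thirteen bad events.\<close>
      have one: "1 \<le> (\<Sum>s\<in>selectors. ?err s Y Z) + ?six Y Z" for Y Z
      proof (cases "\<exists>s\<in>selectors. vote F (select s A) (select s Y) (select s Z) \<noteq> G (select s A)")
        case True
        then obtain s where s: "s \<in> selectors" "?err s Y Z = 1" by auto
        have "?err s Y Z \<le> (\<Sum>s\<in>selectors. ?err s Y Z)"
          using s(1) by (intro member_le_sum) (auto simp: finite_selectors)
        then have "1 \<le> (\<Sum>s\<in>selectors. ?err s Y Z)" using s(2) by linarith
        moreover have "0 \<le> ?six Y Z" by (intro add_nonneg_nonneg) auto
        ultimately show ?thesis by linarith
      next
        case False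
        then have "seven_sum G A = (\<Sum>s\<in>selectors. vote F (select s A) (select s Y) (select s Z))"
          by (simp add: seven_sum_def)
        then have "seven_sum F Y + seven_sum F Z + seven_sum F (A + Y) + seven_sum F (A + Z)
            + seven_sum F (Y + Z) + seven_sum F (A + Y + Z) \<noteq> 0"
          using ne sum_vote_select[of F A Y Z] by simp
        then have "1 \<le> ?six Y Z"
          by (auto simp: of_bool_def)
        moreover have "0 \<le> (\<Sum>s\<in>selectors. ?err s Y Z)" by (intro sum_nonneg) auto
        ultimately show ?thesis by linarith
      qed
      have "n ^ 6 = (\<Sum>Y\<in>?V3. \<Sum>Z\<in>?V3. 1)"
        using cardV3 by (simp flip: power_add)
      also have "\<dots> \<le> (\<Sum>Y\<in>?V3. \<Sum>Z\<in>?V3. (\<Sum>s\<in>selectors. ?err s Y Z) + ?six Y Z)"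
        by (intro sum_mono one)
      also have "\<dots> = (\<Sum>Y\<in>?V3. \<Sum>Z\<in>?V3. \<Sum>s\<in>selectors. ?err s Y Z) + (\<Sum>Y\<in>?V3. \<Sum>Z\<in>?V3. ?six Y Z)"
        by (simp only: sum.distrib)
      also have "(\<Sum>Y\<in>?V3. \<Sum>Z\<in>?V3. \<Sum>s\<in>selectors. ?err s Y Z)
          = (\<Sum>s\<in>selectors. \<Sum>Y\<in>?V3. \<Sum>Z\<in>?V3. ?err s Y Z)"
        by (simp only: sum.swap[of _ _ selectors])
      also have "\<dots> \<le> (\<Sum>s\<in>selectors. 4 * n ^ 3 * ?R)"
      proof (rule sum_mono)
        fix s assume s: "s \<in> selectors"
        let ?a = "select s A"
        have "(\<Sum>Y\<in>?V3. \<Sum>Z\<in>?V3. ?err s Y Z)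
            = (\<Sum>Y\<in>?V3. n\<^sup>2 * (\<Sum>z\<in>V. of_bool (vote F ?a (select s Y) z \<noteq> G ?a)))"
          using sum_triple_select[OF V s] by (intro sum.cong refl) (simp add: n_def)
        also have "\<dots> = n\<^sup>2 * (n\<^sup>2 * (\<Sum>y\<in>V. \<Sum>z\<in>V. of_bool (vote F ?a y z \<noteq> G ?a)))"
          using sum_triple_select[OF V s, of "\<lambda>y. \<Sum>z\<in>V. of_bool (vote F ?a y z \<noteq> G ?a)"]
          by (simp add: n_def flip: sum_distrib_left)
        also have "\<dots> = n ^ 3 * (n * (\<Sum>y\<in>V. \<Sum>z\<in>V. of_bool (vote F ?a y z \<noteq> G ?a)))"
          by (simp add: power2_eq_square power3_eq_cube)
        also have "\<dots> \<le> n ^ 3 * (4 * ?R)"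
          using n by (intro mult_left_mono G select_mem[OF V A]) auto
        finally show "(\<Sum>Y\<in>?V3. \<Sum>Z\<in>?V3. ?err s Y Z) \<le> 4 * n ^ 3 * ?R" by simp
      qed
      also have "(\<Sum>s\<in>selectors. 4 * n ^ 3 * ?R) = 28 * n ^ 3 * ?R"
        by (simp add: card_selectors)
      also have "(\<Sum>Y\<in>?V3. \<Sum>Z\<in>?V3. ?six Y Z) = 6 * n ^ 3 * ?R"
      proof -
        \<comment> \<open>Four of the six triples are translates of \<open>Z\<close>; the other two
          depend on \<open>Y\<close> only and are averaged by the outer sum.\<close>
        have tr: "(\<Sum>Z\<in>?V3. ?\<chi> (B + Z)) = ?R" if "B \<in> ?V3" for B
          using sum_translate[OF V3 that, of ?\<chi>] .
        have "(\<Sum>Z\<in>?V3. ?six Y Z) = n ^ 3 * ?\<chi> Y + ?R + n ^ 3 * ?\<chi> (A + Y) + ?R + ?R + ?R"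
          if "Y \<in> ?V3" for Y
          using tr[OF A] tr[OF that] tr[of "A + Y"] finite_subgroupD(3)[OF V3 A that]
          by (simp add: sum.distrib cardV3)
        then have "(\<Sum>Y\<in>?V3. \<Sum>Z\<in>?V3. ?six Y Z)
            = (\<Sum>Y\<in>?V3. n ^ 3 * ?\<chi> Y + ?R + n ^ 3 * ?\<chi> (A + Y) + ?R + ?R + ?R)"
          by (intro sum.cong) auto
        also have "\<dots> = 6 * n ^ 3 * ?R"
          using tr[OF A] by (simp add: sum.distrib cardV3 flip: sum_distrib_left)
        finally show ?thesis .
      qed
      finally have "n ^ 3 * n ^ 3 \<le> n ^ 3 * (34 * ?R)" by (simp add: algebra_simps flip: power_add)
      then have "n ^ 3 \<le> 34 * ?R" by (rule mult_left_le_imp_le) (use n in simp)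
      then show False using small by (simp add: n_def)
    qed
  next
    \<comment> \<open>Each pair \<open>(y, z)\<close> either violates the identity at
      \<open>(a, y, z)\<close> or votes against \<open>G a\<close>. The second kind makes up at most
      half of the pairs, since 4 \<eta> < 1/2.\<close>
    have half: "n\<^sup>2 \<le> 2 * (\<Sum>y\<in>V. \<Sum>z\<in>V. ?\<chi> (a, y, z))" if a: "a \<in> V" "F a \<noteq> G a" for a
    proof -
      have "n\<^sup>2 = (\<Sum>y\<in>V. \<Sum>z\<in>V. 1)" by (simp add: n_def power2_eq_square)
      also have "\<dots> \<le> (\<Sum>y\<in>V. \<Sum>z\<in>V. ?\<chi> (a, y, z) + of_bool (vote F a y z \<noteq> G a))"
        using a(2) by (intro sum_mono) (auto simp: seven_sum_vote add_eq_0_iff_eq of_bool_def)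
      also have "\<dots> = (\<Sum>y\<in>V. \<Sum>z\<in>V. ?\<chi> (a, y, z)) + (\<Sum>y\<in>V. \<Sum>z\<in>V. of_bool (vote F a y z \<noteq> G a))"
        by (simp only: sum.distrib)
      finally have "n\<^sup>2 \<le> (\<Sum>y\<in>V. \<Sum>z\<in>V. ?\<chi> (a, y, z)) + (\<Sum>y\<in>V. \<Sum>z\<in>V. of_bool (vote F a y z \<noteq> G a))" .
      moreover have "n * (2 * (\<Sum>y\<in>V. \<Sum>z\<in>V. of_bool (vote F a y z \<noteq> G a))) \<le> n * n\<^sup>2"
        using G[OF a(1)] small R0 by (simp add: n_def power3_eq_cube power2_eq_square)
      then have "2 * (\<Sum>y\<in>V. \<Sum>z\<in>V. of_bool (vote F a y z \<noteq> G a)) \<le> n\<^sup>2"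
        using n by (rule mult_left_le_imp_le)
      ultimately show ?thesis by linarith
    qed
    have "n\<^sup>2 * card {x \<in> V. F x \<noteq> G x} = (\<Sum>x | x \<in> V \<and> F x \<noteq> G x. n\<^sup>2)" by simp
    also have "\<dots> \<le> (\<Sum>x | x \<in> V \<and> F x \<noteq> G x. 2 * (\<Sum>y\<in>V. \<Sum>z\<in>V. ?\<chi> (x, y, z)))"
      by (intro sum_mono half) auto
    also have "\<dots> \<le> (\<Sum>x\<in>V. 2 * (\<Sum>y\<in>V. \<Sum>z\<in>V. ?\<chi> (x, y, z)))"
      using finite_subgroupD(1)[OF V] by (intro sum_mono2) (auto intro!: sum_nonneg)
    also have "\<dots> = 2 * ?R" by (simp add: sum_triple flip: sum_distrib_left)
    finally show "(real (card V))\<^sup>2 * real (card {x \<in> V. F x \<noteq> G x}) \<le> 2 * ?R" by (simp add: n_def)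
  qed
qed

section \<open>Random linear maps over the two-element field\<close>

definition vecs :: "nat \<Rightarrow> (nat \<Rightarrow> bit) set" where
  "vecs d = {v. \<forall>i\<ge>d. v i = 0}"

definition to_list :: "nat \<Rightarrow> (nat \<Rightarrow> bit) \<Rightarrow> bool list" where
  "to_list d v = map (\<lambda>i. v i = 1) [0..<d]"

definition of_list :: "bool list \<Rightarrow> nat \<Rightarrow> bit" where
  "of_list x i = of_bool (i < length x \<and> x ! i)"

lemma of_list_mem: "x \<in> cube d \<Longrightarrow> of_list x \<in> vecs d"
  by (auto simp: cube_def vecs_def of_list_def)

lemma to_list_of_list: "x \<in> cube d \<Longrightarrow> to_list d (of_list x) = x"
  by (auto simp: cube_def to_list_def of_list_def intro: nth_equalityI)

lemma of_list_to_list: "v \<in> vecs d \<Longrightarrow> of_list (to_list d v) = v"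
  by (auto simp: vecs_def to_list_def of_list_def fun_eq_iff of_bool_def)

lemma to_list_mem: "to_list d v \<in> cube d"
  by (simp add: cube_def to_list_def)

lemma bij_to_list: "bij_betw (to_list d) (vecs d) (cube d)"
  by (rule bij_betw_byWitness[where f' = of_list])
    (auto simp: of_list_mem to_list_of_list of_list_to_list to_list_mem)

lemma card_vecs: "card (vecs d) = 2 ^ d"
  using bij_betw_same_card[OF bij_to_list, of d] card_lists_length_eq[of "UNIV :: bool set" d]
  by (simp add: cube_def)

lemma finite_subgroup_vecs: "finite_subgroup (vecs d)"
proof -
  have "finite (vecs d)" using card_vecs[of d] by (intro card_ge_0_finite) simp
  then show ?thesis by (auto simp: finite_subgroup_def vecs_def)
qed

text \<open>The matrix X has the columns X 0, ..., X (k - 1).\<close>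
definition lin :: "nat \<Rightarrow> (nat \<Rightarrow> nat \<Rightarrow> bit) \<Rightarrow> (nat \<Rightarrow> bit) \<Rightarrow> nat \<Rightarrow> bit" where
  "lin k X u i = (\<Sum>j<k. u j * X j i)"

text \<open>Columns from \<open>k\<close> on are set to zero, which keeps the set finite, so that a
  uniform matrix exists.\<close>

definition mats :: "nat \<Rightarrow> nat \<Rightarrow> (nat \<Rightarrow> nat \<Rightarrow> bit) set" where
  "mats k d = {X. \<forall>j. (j \<in> {..<k} \<longrightarrow> X j \<in> vecs d) \<and> (j \<notin> {..<k} \<longrightarrow> X j = 0)}"

lemma finite_subgroup_mats: "finite_subgroup (mats k d)"
proof -
  have "finite (mats k d)" unfolding mats_def
    by (rule finite_set_of_finite_funs) (auto intro: finite_subgroupD finite_subgroup_vecs)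
  then show ?thesis
    using finite_subgroupD(2,3)[OF finite_subgroup_vecs] by (auto simp: finite_subgroup_def mats_def)
qed

lemma lin_add_left: "lin k (X + Y) u = lin k X u + lin k Y u"
  by (simp add: lin_def fun_eq_iff algebra_simps sum.distrib)

lemma lin_add_right: "lin k X (u + v) = lin k X u + lin k X v"
  by (simp add: lin_def fun_eq_iff algebra_simps sum.distrib)

lemma lin_0_left: "lin k 0 u = 0"
  by (simp add: lin_def fun_eq_iff)

lemma lin_mem: "X \<in> mats k d \<Longrightarrow> lin k X u \<in> vecs d"
  by (auto simp: lin_def vecs_def mats_def)

definition single_column :: "nat \<Rightarrow> (nat \<Rightarrow> bit) \<Rightarrow> nat \<Rightarrow> nat \<Rightarrow> bit" where
  "single_column j a = (\<lambda>i. if i = j then a else 0)"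

lemma single_column_mem: "j < k \<Longrightarrow> a \<in> vecs d \<Longrightarrow> single_column j a \<in> mats k d"
  using finite_subgroupD(2)[OF finite_subgroup_vecs] by (auto simp: single_column_def mats_def)

lemma lin_single_column: 
  assumes "j < k"
  shows "lin k (single_column j a) u = (if u j = 1 then a else 0)"
proof
  fix i
  have "lin k (single_column j a) u i = (\<Sum>l<k. if l = j then u j * a i else 0)"
    unfolding lin_def single_column_def by (intro sum.cong) auto
  then show "lin k (single_column j a) u i = (if u j = 1 then a else 0) i"
    using assms by auto
qed

lemma vec_nonzeroE:
  assumes "u \<in> vecs k" "u \<noteq> 0"
  obtains j where "j < k" "u j = 1"
proof -
  obtain j where j: "u j \<noteq> 0" using assms(2) by (auto simp: fun_eq_iff)
  then have "j < k" using assms(1) by (auto simp: vecs_def not_le[symmetric])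
  then show ?thesis using that j by simp
qed

text \<open>Two distinct nonzero vectors over the two-element field are linearly independent, so
  both images can be prescribed.\<close>

lemma lin_pair_surj:
  assumes u: "u \<in> vecs k - {0}" and v: "v \<in> vecs k - {0}" and "u \<noteq> v"
    and a: "a \<in> vecs d" and b: "b \<in> vecs d"
  shows "\<exists>X\<in>mats k d. lin k X u = a \<and> lin k X v = b"
proof -
  have sep: "\<exists>X\<in>mats k d. lin k X u = a \<and> lin k X v = b"
    if u: "u \<in> vecs k - {0}" and v: "v \<in> vecs k - {0}"
      and a: "a \<in> vecs d" and b: "b \<in> vecs d" and j: "j < k" "u j = 1" "v j = 0" for u v a b j
  proof -
    obtain l where l: "l < k" "v l = 1" using v by (auto elim: vec_nonzeroE)
    \<comment> \<open>Since \<open>v j = 0\<close>, only column \<open>l\<close> acts on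
      \<open>v\<close>. If \<open>u\<close> meets column \<open>l\<close> as well, the extra
      \<open>b\<close> in column \<open>j\<close> cancels that contribution.\<close>
    let ?X = "single_column j (if u l = 1 then a + b else a) + single_column l b"
    have "?X \<in> mats k d"
      using j l a b by (auto intro!: finite_subgroupD(3)[OF finite_subgroup_mats] single_column_mem
          finite_subgroupD(3)[OF finite_subgroup_vecs])
    moreover have "lin k ?X u = a" "lin k ?X v = b"
      using j l by (auto simp: lin_add_left lin_single_column ac_simps)
    ultimately show ?thesis by blast
  qed
  obtain j where j: "u j \<noteq> v j" using \<open>u \<noteq> v\<close> by (auto simp: fun_eq_iff)
  have jk: "j < k" using j u v by (auto simp: vecs_def not_le[symmetric])
  show ?thesis
  proof (cases "u j = 1")
    case True
    then have "v j = 0" using j by auto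
    then show ?thesis using sep[OF u v a b jk True] by blast
  next
    case False
    then have "u j = 0" "v j = 1" using j by auto
    then show ?thesis using sep[OF v u b a jk] by blast
  qed
qed

section \<open>Three matrices at once: uniform and pairwise independent images\<close>

definition lin3 where
  "lin3 k W u = (lin k (fst W) u, lin k (fst (snd W)) u, lin k (snd (snd W)) u)"

lemma lin3_add_left: "lin3 k (W + W') u = lin3 k W u + lin3 k W' u"
  by (simp add: lin3_def lin_add_left)

lemma lin3_mem: "W \<in> triples (mats k d) \<Longrightarrow> lin3 k W u \<in> triples (vecs d)"
  by (auto simp: lin3_def lin_mem)

lemma select_lin3: "select s (lin3 k W u) = lin k (select s W) u"
  by (auto simp: select_def lin3_def lin_add_left lin_0_left)

lemma lin3_uniform:
  fixes \<phi> :: "_ \<Rightarrow> real"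
  assumes u: "u \<in> vecs k - {0}"
  shows "real (card (triples (vecs d))) * (\<Sum>W\<in>triples (mats k d). \<phi> (lin3 k W u))
    = real (card (triples (mats k d))) * (\<Sum>p\<in>triples (vecs d). \<phi> p)"
proof (rule hom_uniform)
  obtain j where j: "j < k" "u j = 1" using u by (auto elim: vec_nonzeroE)
  show "(\<lambda>W. lin3 k W u) ` triples (mats k d) = triples (vecs d)"
  proof
    show "(\<lambda>W. lin3 k W u) ` triples (mats k d) \<subseteq> triples (vecs d)" using lin3_mem by blast
    show "triples (vecs d) \<subseteq> (\<lambda>W. lin3 k W u) ` triples (mats k d)"
    proof clarify
      fix a b c assume "a \<in> vecs d" "b \<in> vecs d" "c \<in> vecs d"
      then show "(a, b, c) \<in> (\<lambda>W. lin3 k W u) ` triples (mats k d)"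
        using j by (intro image_eqI[of _ _ "(single_column j a, single_column j b, single_column j c)"])
          (auto simp: lin3_def lin_single_column single_column_mem)
    qed
  qed
qed (auto intro!: finite_subgroup_Times finite_subgroup_vecs finite_subgroup_mats simp: lin3_add_left)

text \<open>Pairwise independence: joint evaluation at \<open>u\<close> and \<open>v\<close> is a
  homomorphism, surjective by \<open>lin_pair_surj\<close>, so \<open>hom_uniform\<close> applies to
  it.\<close>

lemma lin3_pair_uniform:
  fixes \<phi> :: "_ \<Rightarrow> _ \<Rightarrow> real"
  assumes u: "u \<in> vecs k - {0}" and v: "v \<in> vecs k - {0}" and "u \<noteq> v"
  shows "(real (card (triples (vecs d))))\<^sup>2 * (\<Sum>W\<in>triples (mats k d). \<phi> (lin3 k W u) (lin3 k W v))
    = real (card (triples (mats k d))) * (\<Sum>p\<in>triples (vecs d). \<Sum>q\<in>triples (vecs d). \<phi> p q)"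
proof -
  let ?D = "\<lambda>W. (lin3 k W u, lin3 k W v)" and ?V = "triples (vecs d)"
  have "real (card (?V \<times> ?V)) * (\<Sum>W\<in>triples (mats k d). case_prod \<phi> (?D W))
      = real (card (triples (mats k d))) * (\<Sum>r\<in>?V \<times> ?V. case_prod \<phi> r)"
  proof (rule hom_uniform)
    show "?D ` triples (mats k d) = ?V \<times> ?V"
    proof
      show "?D ` triples (mats k d) \<subseteq> ?V \<times> ?V" using lin3_mem by blast
      show "?V \<times> ?V \<subseteq> ?D ` triples (mats k d)"
      proof (clarify)
        fix a b c a' b' c' assume "a \<in> vecs d" "b \<in> vecs d" "c \<in> vecs d" "a' \<in> vecs d" "b' \<in> vecs d" "c' \<in> vecs d"
        note m = lin_pair_surj[OF assms(1-3)] and mem = this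
        obtain X Y Z where "X \<in> mats k d" "lin k X u = a" "lin k X v = a'"
          "Y \<in> mats k d" "lin k Y u = b" "lin k Y v = b'"
          "Z \<in> mats k d" "lin k Z u = c" "lin k Z v = c'"
          using m[OF mem(1) mem(4)] m[OF mem(2) mem(5)] m[OF mem(3) mem(6)] by blast
        then show "((a, b, c), a', b', c') \<in> ?D ` triples (mats k d)"
          by (intro image_eqI[of _ _ "(X, Y, Z)"]) (auto simp: lin3_def)
      qed
    qed
  qed (auto intro!: finite_subgroup_Times finite_subgroup_vecs finite_subgroup_mats simp: lin3_add_left)
  then show ?thesis
    by (simp add: card_cartesian_product power2_eq_square sum.cartesian_product)
qed

lemma lin_uniform:
  fixes \<phi> :: "_ \<Rightarrow> real"
  assumes u: "u \<in> vecs k - {0}" and s: "s \<in> selectors"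
  shows "2 ^ d * (\<Sum>W\<in>triples (mats k d). \<phi> (lin k (select s W) u))
    = real (card (triples (mats k d))) * (\<Sum>x\<in>vecs d. \<phi> x)"
proof -
  obtain j where j: "j < k" "u j = 1" using u by (auto elim: vec_nonzeroE)
  have "real (card (vecs d)) * (\<Sum>W\<in>triples (mats k d). \<phi> (lin k (select s W) u))
    = real (card (triples (mats k d))) * (\<Sum>x\<in>vecs d. \<phi> x)"
  proof (rule hom_uniform)
    have "lin k (single_column j a) u = a" for a using j by (simp add: lin_single_column)
    then have "(\<lambda>X. lin k X u) ` mats k d = vecs d"
      using single_column_mem[OF j(1)] by (auto simp: lin_mem) (metis image_eqI)
    then show "(\<lambda>W. lin k (select s W) u) ` triples (mats k d) = vecs d"
      using select_surj[OF finite_subgroup_mats s, of k d] image_image[of "\<lambda>X. lin k X u" "select s" "triples (mats k d)"]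
      by simp
  qed (auto intro!: finite_subgroup_Times finite_subgroup_vecs finite_subgroup_mats
        simp: select_add lin_add_left)
  then show ?thesis by (simp add: card_vecs)
qed

section \<open>Quadratic forms\<close>

definition qform :: "nat \<Rightarrow> (nat \<Rightarrow> bit) \<Rightarrow> (nat \<Rightarrow> nat \<Rightarrow> bit) \<Rightarrow> (nat \<Rightarrow> bit) \<Rightarrow> bit" where
  "qform d a b v = (\<Sum>i<d. a i * v i) + (\<Sum>i<d. \<Sum>j<d. b i j * v i * v j)"

text \<open>A form is an additive map plus the diagonal of a biadditive one. In the expanded
  seven-point sum every linear and every bilinear term occurs an even number of times.\<close>

lemma seven_sum_qform: "seven_sum (qform d a b) p = 0"
proof -
  obtain x y z where p: "p = (x, y, z)" by (metis prod_cases3)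
  define l where "l v = (\<Sum>i<d. a i * v i)" for v
  define B where "B v w = (\<Sum>i<d. \<Sum>j<d. b i j * v i * w j)" for v w
  have "l (v + w) = l v + l w" for v w
    by (simp add: l_def distrib_left sum.distrib)
  moreover have "B (v + w) r = B v r + B w r" "B r (v + w) = B r v + B r w" for v w r
    by (simp_all add: B_def distrib_left distrib_right sum.distrib)
  moreover have "qform d a b = (\<lambda>v. l v + B v v)"
    by (simp add: fun_eq_iff qform_def l_def B_def)
  ultimately show ?thesis
    by (simp add: p seven_sum_eq ac_simps)
qed

section \<open>Solutions of the seven-point identity are quadratic forms\<close>

definition unit :: "nat \<Rightarrow> nat \<Rightarrow> bit" where
  "unit i = (\<lambda>j. of_bool (j = i))"

lemma vecs_Suc_cases:
  assumes "v \<in> vecs (Suc n)"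
  obtains "v \<in> vecs n" "v n = 0" | w where "w \<in> vecs n" "v = w + unit n" "v n = 1"
proof (cases "v n = 1")
  case True
  let ?w = "v + unit n"
  have "?w \<in> vecs n"
    using assms True by (auto simp: vecs_def unit_def)
  moreover have "v = ?w + unit n" by (simp add: add.assoc)
  ultimately show ?thesis using that(2) True by blast
next
  case False
  then have "v \<in> vecs n" using assms unfolding vecs_def
    by (auto simp: Suc_le_eq) (metis le_less)
  then show ?thesis using that(1) False by simp
qed

lemma unit_mem: "i < n \<Longrightarrow> unit i \<in> vecs n"
  by (auto simp: unit_def vecs_def)

lemma vecs_mono: "m \<le> n \<Longrightarrow> vecs m \<subseteq> vecs n"
  by (auto simp: vecs_def)

lemma additive_expansion:
  fixes h :: "(nat \<Rightarrow> bit) \<Rightarrow> bit"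
  assumes "\<And>x y. x \<in> vecs n \<Longrightarrow> y \<in> vecs n \<Longrightarrow> h (x + y) = h x + h y" and "v \<in> vecs n"
  shows "h v = (\<Sum>i<n. h (unit i) * v i)"
  using assms
proof (induction n arbitrary: v)
  case 0
  then have "v = 0" by (auto simp: vecs_def fun_eq_iff)
  moreover have "h 0 = 0" using "0.prems"(1)[of 0 0] finite_subgroupD(2)[OF finite_subgroup_vecs, of 0]
    by (metis add_self)
  ultimately show ?case by (simp only: lessThan_0 sum.empty)
next
  case (Suc n)
  have sub: "vecs n \<subseteq> vecs (Suc n)" by (rule vecs_mono) simp
  have IH: "h w = (\<Sum>i<n. h (unit i) * w i)" if "w \<in> vecs n" for w
    using Suc.IH[OF _ that] Suc.prems(1) sub by blast
  show ?case using Suc.prems(2)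
  proof (cases rule: vecs_Suc_cases)
    case 1
    then show ?thesis using IH by simp
  next
    case (2 w)
    have "h v = h w + h (unit n)"
      unfolding 2(2) by (rule Suc.prems(1)) (use 2(1) sub unit_mem in auto)
    also have "h w = (\<Sum>i<n. h (unit i) * v i)"
      unfolding IH[OF 2(1)] by (intro sum.cong) (auto simp: 2(2) unit_def)
    finally show ?thesis using 2(3) by simp
  qed
qed

text \<open>The converse of \<open>seven_sum_qform\<close>. The identity for
  \<open>(x, y, unit n)\<close> says that the polar form \<open>\<beta>\<close> is additive in its
  first argument when the second is \<open>unit n\<close>. Hence
  \<open>G (w + unit n) = G w + G (unit n) + \<beta> w (unit n)\<close> adds only a linear term and
  products with the last coordinate.\<close>

lemma qform_expansion:
  fixes G :: "(nat \<Rightarrow> bit) \<Rightarrow> bit"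
  assumes "\<And>p. p \<in> triples (vecs n) \<Longrightarrow> seven_sum G p = 0"
  shows "\<exists>a b. \<forall>v\<in>vecs n. G v = qform n a b v"
proof -
  define \<beta> where "\<beta> x y = G (x + y) + G x + G y" for x y
  define a where "a i = G (unit i)" for i
  \<comment> \<open>Strictly upper triangular, so each unordered pair is used once. The coefficients
    do not depend on \<open>n\<close>, so one choice serves the whole induction.\<close>
  define b where "b i j = of_bool (i < j) * \<beta> (unit i) (unit j)" for i j
  have "\<forall>v\<in>vecs n. G v = qform n a b v"
    using assms
  proof (induction n)
    case 0
    have "G 0 = 0" using "0.prems"[of 0]
      by (simp add: vecs_def zero_prod_def seven_sum_eq)
    moreover have "vecs 0 = {0}" by (auto simp: vecs_def fun_eq_iff)
    moreover have "qform 0 a b v = 0" for v by (simp add: qform_def)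
    ultimately show ?case by (metis singletonD)
  next
    case (Suc n)
    have sub: "vecs n \<subseteq> vecs (Suc n)" by (rule vecs_mono) simp
    have IH: "\<forall>v\<in>vecs n. G v = qform n a b v"
      by (rule Suc.IH, rule Suc.prems) (use sub in blast)
    \<comment> \<open>The new row of \<open>b\<close> vanishes up to column \<open>n\<close>, so
      only the new column contributes.\<close>
    have Suc_eq: "qform (Suc n) a b v = qform n a b v + a n * v n
        + (\<Sum>i<n. \<beta> (unit i) (unit n) * v i) * v n" for v
      by (simp add: qform_def b_def sum.distrib sum_distrib_left ac_simps)
    have cong: "qform n a b v = qform n a b w" if "\<And>i. i < n \<Longrightarrow> v i = w i" for v w
      using that by (simp add: qform_def)
    show ?case
    proof
      fix v assume "v \<in> vecs (Suc n)"
      then show "G v = qform (Suc n) a b v"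
      proof (cases rule: vecs_Suc_cases)
        case 1
        then show ?thesis using IH Suc_eq by simp
      next
        case (2 w)
        have "\<beta> (x + y) (unit n) = \<beta> x (unit n) + \<beta> y (unit n)" if "x \<in> vecs n" "y \<in> vecs n" for x y
        proof -
          have "seven_sum G (x, y, unit n) = 0"
            using that sub by (intro Suc.prems) (auto simp: unit_mem)
          then have "(G x + G y + G (unit n) + G (x + y) + G (x + unit n) + G (y + unit n) + G (x + y + unit n))
              + (\<beta> x (unit n) + \<beta> y (unit n)) = \<beta> x (unit n) + \<beta> y (unit n)"
            by (simp add: seven_sum_eq)
          then show ?thesis by (simp add: \<beta>_def ac_simps)
        qed
        then have "\<beta> w (unit n) = (\<Sum>i<n. \<beta> (unit i) (unit n) * w i)"
          by (rule additive_expansion) (use 2 in auto)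
        moreover have wv: "w i = v i" if "i < n" for i using that by (simp add: 2(2) unit_def)
        moreover have "G v = G w + G (unit n) + \<beta> w (unit n)"
          by (simp add: \<beta>_def 2(2) ac_simps)
        moreover have "G w = qform n a b v"
          using IH 2(1) cong[OF wv] by simp
        ultimately show ?thesis by (simp add: Suc_eq 2(3) a_def)
      qed
    qed
  qed
  then show ?thesis by blast
qed

lemma of_bool_odd_bit: "of_bool (odd n) = (of_nat n :: bit)"
  by (induction n) auto

lemma qform_to_list:
  assumes "v \<in> vecs d"
  shows "of_bool (odd (card {i. i < d \<and> a i \<and> to_list d v ! i}
     + card {(i, j). i < d \<and> j < d \<and> b i j \<and> to_list d v ! i \<and> to_list d v ! j}))
     = qform d (\<lambda>i. of_bool (a i)) (\<lambda>i j. of_bool (b i j)) v"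
proof -
  have "of_nat (card {i. i < d \<and> a i \<and> to_list d v ! i}) = (\<Sum>i<d. of_bool (a i) * v i)"
  proof -
    have "{i. i < d \<and> a i \<and> to_list d v ! i} = {i \<in> {..<d}. a i \<and> v i = 1}"
      by (auto simp: to_list_def)
    then have "of_nat (card {i. i < d \<and> a i \<and> to_list d v ! i}) = (\<Sum>i | i \<in> {..<d} \<and> a i \<and> v i = 1. 1 :: bit)"
      by simp
    also have "\<dots> = (\<Sum>i<d. if a i \<and> v i = 1 then 1 else 0)"
      by (subst sum.inter_filter) auto
    also have "\<dots> = (\<Sum>i<d. of_bool (a i) * v i)"
      by (intro sum.cong) auto
    finally show ?thesis .
  qed
  moreover have "of_nat (card {(i, j). i < d \<and> j < d \<and> b i j \<and> to_list d v ! i \<and> to_list d v ! j})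
     = (\<Sum>i<d. \<Sum>j<d. of_bool (b i j) * v i * v j)"
  proof -
    have "{(i, j). i < d \<and> j < d \<and> b i j \<and> to_list d v ! i \<and> to_list d v ! j}
       = {r \<in> {..<d} \<times> {..<d}. b (fst r) (snd r) \<and> v (fst r) = 1 \<and> v (snd r) = 1}"
      by (auto simp: to_list_def)
    then have "of_nat (card {(i, j). i < d \<and> j < d \<and> b i j \<and> to_list d v ! i \<and> to_list d v ! j})
      = (\<Sum>r | r \<in> {..<d} \<times> {..<d} \<and> b (fst r) (snd r) \<and> v (fst r) = 1 \<and> v (snd r) = 1. 1 :: bit)"
      by simp
    also have "\<dots> = (\<Sum>r\<in>{..<d} \<times> {..<d}. if b (fst r) (snd r) \<and> v (fst r) = 1 \<and> v (snd r) = 1 then 1 else 0)"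
      by (subst sum.inter_filter) auto
    also have "\<dots> = (\<Sum>r\<in>{..<d} \<times> {..<d}. of_bool (b (fst r) (snd r)) * v (fst r) * v (snd r))"
      by (intro sum.cong) auto
    finally show ?thesis by (simp add: sum.cartesian_product case_prod_beta)
  qed
  ultimately show ?thesis by (simp only: of_bool_odd_bit qform_def of_nat_add)
qed

lemma quadratic_seven_sum:
  assumes "quadratic d g" "p \<in> triples (vecs d)"
  shows "seven_sum (\<lambda>v. of_bool (g (to_list d v))) p = 0"
proof -
  obtain a b where "\<forall>x\<in>cube d. g x = odd (card {i. i < d \<and> a i \<and> x ! i}
     + card {(i, j). i < d \<and> j < d \<and> b i j \<and> x ! i \<and> x ! j})"
    using assms(1) unfolding quadratic_def by blast
  then have "of_bool (g (to_list d v)) = qform d (\<lambda>i. of_bool (a i)) (\<lambda>i j. of_bool (b i j)) v"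
    if "v \<in> vecs d" for v
    using qform_to_list[OF that] to_list_mem by simp
  then have "seven_sum (\<lambda>v. of_bool (g (to_list d v))) p
      = seven_sum (qform d (\<lambda>i. of_bool (a i)) (\<lambda>i j. of_bool (b i j))) p"
    unfolding seven_sum_def
    using select_mem[OF finite_subgroup_vecs assms(2)] by (intro sum.cong) auto
  then show ?thesis by (simp add: seven_sum_qform)
qed

lemma seven_sum_quadratic:
  assumes "\<And>p. p \<in> triples (vecs d) \<Longrightarrow> seven_sum G p = 0"
  shows "quadratic d (\<lambda>x. G (of_list x) = 1)"
proof -
  obtain a b where ab: "\<forall>v\<in>vecs d. G v = qform d a b v"
    using qform_expansion[OF assms] by blast
  let ?a = "\<lambda>i. a i = 1" and ?b = "\<lambda>i j. b i j = 1"
  have bits: "of_bool (c = 1) = c" for c :: bit by (cases c) auto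
  have "(G (of_list x) = 1) = odd (card {i. i < d \<and> ?a i \<and> x ! i}
     + card {(i, j). i < d \<and> j < d \<and> ?b i j \<and> x ! i \<and> x ! j})" (is "_ = odd ?n") if x: "x \<in> cube d" for x
  proof -
    have "G (of_list x) = of_bool (odd ?n)"
      using qform_to_list[OF of_list_mem[OF x], of ?a ?b] ab of_list_mem[OF x]
      by (simp add: bits to_list_of_list[OF x])
    then show ?thesis by simp
  qed
  then show ?thesis unfolding quadratic_def by (intro exI[of _ ?a] exI[of _ ?b]) blast
qed

text \<open>If 34 \<eta> < 1, self-correction yields a quadratic function at relative distance at
  most 2 \<eta>, so \<eta> is at least \<open>eps / 2\<close>. Otherwise \<eta> is at least 1/34,
  which exceeds \<open>eps / 34\<close>.\<close>

lemma far_violations: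
  assumes far: "far_from_quadratic d eps f" and eps: "0 < eps" "eps < 1"
  shows "eps / 34 * real (card (triples (vecs d))) \<le> violations (vecs d) (\<lambda>v. of_bool (f (to_list d v)))"
proof -
  let ?F = "\<lambda>v. of_bool (f (to_list d v)) :: bit" and ?V = "vecs d"
  let ?R = "violations ?V ?F"
  define n where "n = real (card ?V)"
  have n: "n > 0" "n = 2 ^ d" by (simp_all add: n_def card_vecs)
  have card3: "real (card (triples ?V)) = n ^ 3"
    by (simp add: n_def card_cartesian_product power3_eq_cube)
  have "eps / 34 * n ^ 3 \<le> ?R"
  proof (cases "34 * ?R < n ^ 3")
    case True
    then have "34 * ?R < real (card ?V) ^ 3" by (simp add: n_def)
    from self_correction[OF finite_subgroup_vecs this] obtain G
      where G: "\<And>p. p \<in> triples ?V \<Longrightarrow> seven_sum G p = 0"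
        and dist: "n\<^sup>2 * real (card {v \<in> ?V. ?F v \<noteq> G v}) \<le> 2 * ?R"
      unfolding n_def by blast
    let ?g = "\<lambda>x. G (of_list x) = 1"
    have "eps * n \<le> card {x \<in> cube d. f x \<noteq> ?g x}"
      using far seven_sum_quadratic[of d G, OF G] unfolding far_from_quadratic_def n by blast
    also have "card {x \<in> cube d. f x \<noteq> ?g x} = card {v \<in> ?V. ?F v \<noteq> G v}"
    proof (rule bij_betw_same_card[symmetric])
      show "bij_betw (to_list d) {v \<in> ?V. ?F v \<noteq> G v} {x \<in> cube d. f x \<noteq> ?g x}"
        by (rule bij_betw_byWitness[where f' = of_list])
          (auto simp: of_list_mem to_list_of_list of_list_to_list to_list_mem of_bool_def split: if_splits)
    qed
    finally have "n\<^sup>2 * (eps * n) \<le> n\<^sup>2 * real (card {v \<in> ?V. ?F v \<noteq> G v})"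
      by (intro mult_left_mono) auto
    also note dist
    finally have *: "eps * n ^ 3 \<le> 2 * ?R" by (simp add: power2_eq_square power3_eq_cube mult_ac)
    have "eps / 34 * n ^ 3 \<le> eps / 2 * n ^ 3" using eps n by (intro mult_right_mono) auto
    then show ?thesis using * by simp
  next
    case False
    have "eps * n ^ 3 \<le> 1 * n ^ 3" using eps n by (intro mult_right_mono) auto
    then show ?thesis using False by simp
  qed
  then show ?thesis by (simp add: card3)
qed

section \<open>Erasures and consistency of random samples\<close>

lemma of_bool_Bex_le_sum:
  assumes "finite H"
  shows "of_bool (\<exists>h\<in>H. Q h) \<le> (\<Sum>h\<in>H. of_bool (Q h) :: real)"
proof (cases "\<exists>h\<in>H. Q h")
  case True
  then obtain h where h: "h \<in> H" "Q h" by blast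
  have "of_bool (Q h) \<le> (\<Sum>h\<in>H. of_bool (Q h) :: real)"
    by (rule member_le_sum) (use h assms in auto)
  then show ?thesis using True h by simp
next
  case False
  have "0 \<le> (\<Sum>h\<in>H. of_bool (Q h) :: real)" by (intro sum_nonneg) auto
  then show ?thesis using False by simp
qed

text \<open>A uniform word is a sequence of \<open>n\<close> independent uniform samples.\<close>

definition words :: "'p set \<Rightarrow> nat \<Rightarrow> 'p list set" where
  "words P n = {us. set us \<subseteq> P \<and> length us = n}"

lemma finite_words: "finite P \<Longrightarrow> finite (words P n)"
  and card_words: "finite P \<Longrightarrow> card (words P n) = card P ^ n"
  by (simp_all add: words_def finite_lists_length_eq card_lists_length_eq)

lemma sum_words_Suc:
  "(\<Sum>us\<in>words P (Suc n). \<phi> us) = (\<Sum>x\<in>P. \<Sum>us\<in>words P n. \<phi> (x # us))"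
proof -
  have "(\<Sum>x\<in>P. \<Sum>us\<in>words P n. \<phi> (x # us)) = (\<Sum>r\<in>P \<times> words P n. \<phi> (fst r # snd r))"
    by (simp add: sum.cartesian_product case_prod_beta)
  also have "\<dots> = (\<Sum>us\<in>words P (Suc n). \<phi> us)"
    by (rule sum.reindex_bij_witness[where i = "\<lambda>us. (hd us, tl us)" and j = "\<lambda>r. fst r # snd r"])
      (auto simp: words_def length_Suc_conv)
  finally show ?thesis by simp
qed

text \<open>Until the first erased query the adversary's history consists of true values, so this
  run records \<open>Some (f x)\<close> without a case distinction.\<close>

fun unerased :: "(bool list \<Rightarrow> bool) \<Rightarrow> adversary \<Rightarrow> bool list set \<Rightarrow>
    (bool list \<times> bool option) list \<Rightarrow> bool list list \<Rightarrow> bool" where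
  "unerased f A E h [] = True"
| "unerased f A E h (x # xs) = (x \<notin> E \<and>
     (let h' = h @ [(x, Some (f x))] in unerased f A (E \<union> A h') h' xs))"

lemma run_aux_unerased:
  "unerased f A E h xs \<Longrightarrow> run_aux f A E h xs = h @ map (\<lambda>x. (x, Some (f x))) xs"
  by (induction xs arbitrary: E h) (auto simp: Let_def)

lemma oracle_answers_unerased:
  "unerased f A {} [] qs \<Longrightarrow> oracle_answers f A qs = map (\<lambda>x. Some (f x)) qs"
  by (simp add: oracle_answers_def run_aux_unerased)

text \<open>At most \<open>card E + t * n\<close> points are erased before any of the
  \<open>n\<close> queries, and each of them is hit by at most \<open>c\<close> samples. The next
  sample is independent of the past, so a union bound over the queries applies. The adversary is
  arbitrary for the given \<open>q\<close> and may therefore know the random matrices behind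
  it.\<close>

lemma erasure_bound:
  fixes q :: "'p \<Rightarrow> bool list" and c :: real
  assumes P: "finite P" and A: "valid_adversary d t A" and c: "c \<ge> 0"
    and fibre: "\<And>E. finite E \<Longrightarrow> card {p \<in> P. q p \<in> E} \<le> c * card E"
    and E: "finite E"
  shows "real (card P) * (\<Sum>us\<in>words P n. of_bool (\<not> unerased f A E h (map q us)))
    \<le> n * c * (card E + t * n) * real (card P) ^ n"
  using E
proof (induction n arbitrary: E h)
  case 0
  then show ?case by (simp add: words_def)
next
  case (Suc n)
  let ?M = "real (card P)"
  define h' where "h' p = h @ [(q p, Some (f (q p)))]" for p
  define E' where "E' p = E \<union> A (h' p)" for p
  have E': "finite (E' p)" "card (E' p) \<le> card E + t" for p
    using A Suc.prems card_Un_le[of E "A (h' p)"]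
    by (auto simp: E'_def valid_adversary_def intro: order.trans)
  have "(\<Sum>us\<in>words P (Suc n). of_bool (\<not> unerased f A E h (map q us)))
     = (\<Sum>p\<in>P. \<Sum>us\<in>words P n. of_bool (\<not> (q p \<notin> E \<and> unerased f A (E' p) (h' p) (map q us))) :: real)"
    by (simp add: sum_words_Suc E'_def h'_def Let_def)
  also have "\<dots> \<le> (\<Sum>p\<in>P. \<Sum>us\<in>words P n.
      of_bool (q p \<in> E) + of_bool (\<not> unerased f A (E' p) (h' p) (map q us)))"
    by (intro sum_mono) auto
  also have "\<dots> = ?M ^ n * (\<Sum>p\<in>P. of_bool (q p \<in> E))
      + (\<Sum>p\<in>P. \<Sum>us\<in>words P n. of_bool (\<not> unerased f A (E' p) (h' p) (map q us)))"
    by (simp add: sum.distrib card_words P sum_distrib_left del: sum_of_bool_eq)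
  also have "(\<Sum>p\<in>P. of_bool (q p \<in> E)) = real (card {p \<in> P. q p \<in> E})"
    using P by (simp add: Int_def)
  finally have "?M * (\<Sum>us\<in>words P (Suc n). of_bool (\<not> unerased f A E h (map q us)))
      \<le> ?M * (?M ^ n * real (card {p \<in> P. q p \<in> E})
        + (\<Sum>p\<in>P. \<Sum>us\<in>words P n. of_bool (\<not> unerased f A (E' p) (h' p) (map q us))))"
    by (intro mult_left_mono) auto
  also have "\<dots> = ?M ^ Suc n * real (card {p \<in> P. q p \<in> E})
        + (\<Sum>p\<in>P. ?M * (\<Sum>us\<in>words P n. of_bool (\<not> unerased f A (E' p) (h' p) (map q us))))"
    by (simp only: distrib_left sum_distrib_left power_Suc mult_ac)
  also have "\<dots> \<le> ?M ^ Suc n * (c * card E) + (\<Sum>p\<in>P. n * c * (card E + t * Suc n) * ?M ^ n)"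
  proof (intro add_mono mult_left_mono sum_mono)
    show "real (card {p \<in> P. q p \<in> E}) \<le> c * card E" by (rule fibre[OF Suc.prems])
    fix p
    have "?M * (\<Sum>us\<in>words P n. of_bool (\<not> unerased f A (E' p) (h' p) (map q us)))
        \<le> n * c * (card (E' p) + t * n) * ?M ^ n"
      using Suc.IH[OF E'(1)] by simp
    also have "\<dots> \<le> n * c * (card E + t * Suc n) * ?M ^ n"
    proof (intro mult_right_mono mult_left_mono)
      have "card (E' p) + t * n \<le> card E + t * Suc n" using E'(2)[of p] by simp
      then show "real (card (E' p) + t * n) \<le> real (card E + t * Suc n)" by (rule of_nat_mono)
    qed (use c in auto)
    finally show "?M * (\<Sum>us\<in>words P n. of_bool (\<not> unerased f A (E' p) (h' p) (map q us)))
        \<le> n * c * (card E + t * Suc n) * ?M ^ n" .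
  qed auto
  also have "\<dots> = (c * card E + n * c * (card E + t * Suc n)) * ?M ^ Suc n"
    by (simp add: algebra_simps)
  also have "\<dots> \<le> (c * (card E + t * Suc n) + n * c * (card E + t * Suc n)) * ?M ^ Suc n"
    using c by (intro mult_right_mono add_mono mult_left_mono) auto
  also have "\<dots> = Suc n * c * (card E + t * Suc n) * ?M ^ Suc n"
    by (simp add: algebra_simps)
  finally show ?case by simp
qed

text \<open>By the minimum distance of H, at most one member of H lies close to \<open>\<Phi>\<close>; only for that one
  is the weaker bound \<open>\<alpha>\<close> on the disagreement used.\<close>
lemma consistent_bound:
  fixes \<Phi> :: "'p \<Rightarrow> 'b" and \<alpha> \<beta> :: real
  assumes P: "finite P" and H: "finite H"
    and \<alpha>: "\<And>h. h \<in> H \<Longrightarrow> \<alpha> * card P \<le> card {p \<in> P. \<Phi> p \<noteq> h p}"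
    and \<beta>: "\<And>h h'. h \<in> H \<Longrightarrow> h' \<in> H \<Longrightarrow> h \<noteq> h' \<Longrightarrow> 2 * \<beta> * card P \<le> card {p \<in> P. h p \<noteq> h' p}"
    and range: "\<alpha> \<le> 1" "\<beta> \<le> 1"
  shows "(\<Sum>us\<in>words P n. of_bool (\<exists>h\<in>H. \<forall>p\<in>set us. \<Phi> p = h p))
    \<le> ((1 - \<alpha>) ^ n + card H * (1 - \<beta>) ^ n) * real (card P) ^ n"
proof -
  let ?M = "real (card P)"
  define agr where "agr h = {p \<in> P. \<Phi> p = h p}" for h
  define dis where "dis h = {p \<in> P. \<Phi> p \<noteq> h p}" for h
  have agr_dis: "real (card (agr h)) = ?M - card (dis h)" for h
  proof -
    have "card P = card (agr h) + card (dis h)"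
      unfolding agr_def dis_def using P by (subst card_Un_disjoint[symmetric]) (auto intro!: arg_cong[where f = card])
    then show ?thesis by simp
  qed
  have pow: "real (card (agr h)) ^ n \<le> (1 - \<gamma>) ^ n * ?M ^ n" if "\<gamma> * ?M \<le> card (dis h)" "\<gamma> \<le> 1" for \<gamma> h
  proof -
    have "real (card (agr h)) \<le> (1 - \<gamma>) * ?M" using that agr_dis[of h] by (simp add: algebra_simps)
    then show ?thesis by (simp add: power_mono flip: power_mult_distrib)
  qed
  have "(\<Sum>us\<in>words P n. of_bool (\<exists>h\<in>H. \<forall>p\<in>set us. \<Phi> p = h p))
     \<le> (\<Sum>us\<in>words P n. \<Sum>h\<in>H. of_bool (\<forall>p\<in>set us. \<Phi> p = h p) :: real)"
    by (intro sum_mono of_bool_Bex_le_sum H)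
  also have "\<dots> = (\<Sum>h\<in>H. real (card (agr h)) ^ n)"
  proof (subst sum.swap, rule sum.cong[OF refl])
    fix h
    have "words P n \<inter> {us. \<forall>p\<in>set us. \<Phi> p = h p} = words (agr h) n"
      by (auto simp: words_def agr_def)
    moreover have "finite (agr h)" using P by (simp add: agr_def)
    ultimately show "(\<Sum>us\<in>words P n. of_bool (\<forall>p\<in>set us. \<Phi> p = h p)) = real (card (agr h)) ^ n"
      using finite_words[OF P] by (simp add: card_words)
  qed
  also have "\<dots> \<le> ((1 - \<alpha>) ^ n + card H * (1 - \<beta>) ^ n) * ?M ^ n"
  proof (cases "\<exists>h0\<in>H. card (dis h0) < \<beta> * ?M")
    case True
    then obtain h0 where h0: "h0 \<in> H" "card (dis h0) < \<beta> * ?M" by blast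
    \<comment> \<open>Triangle inequality: \<open>h\<close> and \<open>h0\<close> differ on a
      fraction of at least 2 \<beta>, and \<open>h0\<close> misses \<Phi> on less than
      \<beta>.\<close>
    have other: "\<beta> * ?M \<le> card (dis h)" if h: "h \<in> H - {h0}" for h
    proof -
      have "2 * \<beta> * ?M \<le> card {p \<in> P. h p \<noteq> h0 p}" using \<beta> h h0(1) by blast
      also have "\<dots> \<le> card (dis h \<union> dis h0)"
        using P by (intro of_nat_mono card_mono) (auto simp: dis_def)
      also have "\<dots> \<le> card (dis h) + card (dis h0)" by (intro of_nat_mono card_Un_le)
      finally show ?thesis using h0(2) by simp
    qed
    have "(\<Sum>h\<in>H. real (card (agr h)) ^ n) = real (card (agr h0)) ^ n + (\<Sum>h\<in>H - {h0}. real (card (agr h)) ^ n)"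
      by (rule sum.remove[OF H h0(1)])
    also have "\<dots> \<le> (1 - \<alpha>) ^ n * ?M ^ n + (\<Sum>h\<in>H - {h0}. (1 - \<beta>) ^ n * ?M ^ n)"
      using \<alpha>[OF h0(1)] other range by (intro add_mono sum_mono pow) (auto simp: dis_def)
    also have "\<dots> \<le> (1 - \<alpha>) ^ n * ?M ^ n + card H * ((1 - \<beta>) ^ n * ?M ^ n)"
      using range H by (auto intro!: mult_right_mono card_mono)
    finally show ?thesis by (simp add: algebra_simps)
  next
    case False
    have "(\<Sum>h\<in>H. real (card (agr h)) ^ n) \<le> (\<Sum>h\<in>H. (1 - \<beta>) ^ n * ?M ^ n)"
      using False range by (intro sum_mono pow) (auto simp: not_less)
    also have "\<dots> \<le> ((1 - \<alpha>) ^ n + card H * (1 - \<beta>) ^ n) * ?M ^ n"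
      using range by (simp add: algebra_simps)
    finally show ?thesis .
  qed
  finally show ?thesis .
qed

text \<open>If the value at \<open>a\<close> is nonzero, then for all \<open>y\<close> and
  \<open>z\<close> one of the other six points of the identity carries a nonzero value. Each of
  these points is uniform, so the density of nonzero values is at least 1/6. This serves as a
  minimum distance for quadratic functions.\<close>

lemma seven_sum_density:
  assumes V: "finite_subgroup V" and zero: "\<And>p. p \<in> triples V \<Longrightarrow> seven_sum \<phi> p = 0"
    and a: "a \<in> V" "\<phi> a \<noteq> 0"
  shows "card V \<le> 6 * card {v \<in> V. \<phi> v \<noteq> 0}"
proof -
  let ?\<chi> = "\<lambda>v. of_bool (\<phi> v \<noteq> 0) :: real"
  define n where "n = real (card V)"
  define c where "c = (\<Sum>v\<in>V. ?\<chi> v)"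
  have n: "n > 0" using finite_subgroupD(4)[OF V] by (simp add: n_def)
  have tr: "(\<Sum>v\<in>V. ?\<chi> (x + v)) = c" if "x \<in> V" for x
    using sum_translate[OF V that, of ?\<chi>] by (simp add: c_def)
  have "n * n = (\<Sum>y\<in>V. \<Sum>z\<in>V. 1)" by (simp add: n_def)
  also have "\<dots> \<le> (\<Sum>y\<in>V. \<Sum>z\<in>V. ?\<chi> y + ?\<chi> z + ?\<chi> (a + y) + ?\<chi> (a + z) + ?\<chi> (y + z) + ?\<chi> ((a + y) + z))"
  proof (intro sum_mono)
    fix y z assume "y \<in> V" "z \<in> V"
    then have "\<phi> a + vote \<phi> a y z = 0" using zero[of "(a, y, z)"] a by (simp add: seven_sum_vote)
    then have "vote \<phi> a y z \<noteq> 0" using a(2) by (metis add_eq_0_iff_eq)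
    then show "1 \<le> ?\<chi> y + ?\<chi> z + ?\<chi> (a + y) + ?\<chi> (a + z) + ?\<chi> (y + z) + ?\<chi> ((a + y) + z)"
      by (auto simp: vote_def of_bool_def)
  qed
  also have "\<dots> = (\<Sum>y\<in>V. n * ?\<chi> y + c + n * ?\<chi> (a + y) + c + c + c)"
  proof (rule sum.cong[OF refl])
    fix y assume y: "y \<in> V"
    show "(\<Sum>z\<in>V. ?\<chi> y + ?\<chi> z + ?\<chi> (a + y) + ?\<chi> (a + z) + ?\<chi> (y + z) + ?\<chi> ((a + y) + z))
        = n * ?\<chi> y + c + n * ?\<chi> (a + y) + c + c + c"
      using tr[OF a(1)] tr[OF y] tr[OF finite_subgroupD(3)[OF V a(1) y]]
      by (simp only: sum.distrib n_def c_def sum_constant)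
  qed
  also have "\<dots> = n * (6 * c)"
    using tr[OF a(1)] by (simp only: sum.distrib flip: sum_distrib_left) (simp add: c_def n_def)
  finally have "n \<le> 6 * c" by (rule mult_left_le_imp_le) (rule n)
  moreover have "c = card {v \<in> V. \<phi> v \<noteq> 0}"
    using finite_subgroupD(1)[OF V] by (simp add: c_def Int_def)
  ultimately show ?thesis by (simp add: n_def)
qed

section \<open>The sampled structure\<close>

definition nonzero :: "nat \<Rightarrow> (nat \<Rightarrow> bit) set" where
  "nonzero k = vecs k - {0}"

lemma card_nonzero: "real (card (nonzero k)) = 2 ^ k - 1" and finite_nonzero: "finite (nonzero k)"
  using finite_subgroupD(1,2)[OF finite_subgroup_vecs, of k]
  by (simp_all add: nonzero_def card_vecs of_nat_diff)

text \<open>Chebyshev's inequality for the number of violated triples \<open>lin3 k W u\<close>, which are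
  pairwise independent over u.\<close>
lemma violations_concentrate:
  fixes F :: "(nat \<Rightarrow> bit) \<Rightarrow> bit" and \<eta> :: real
  assumes \<eta>: "violations (vecs d) F = \<eta> * card (triples (vecs d))"
  shows "\<eta> * card (nonzero k) *
      (\<Sum>W\<in>triples (mats k d). of_bool ((\<Sum>u\<in>nonzero k. of_bool (seven_sum F (lin3 k W u) \<noteq> 0)) < \<eta> * card (nonzero k) / 2))
    \<le> 4 * card (triples (mats k d))"
proof -
  let ?\<Omega> = "triples (mats k d)" and ?V = "triples (vecs d)" and ?U = "nonzero k"
  let ?\<chi> = "\<lambda>p. of_bool (seven_sum F p \<noteq> 0) :: real"
  define Z where "Z W = (\<Sum>u\<in>?U. ?\<chi> (lin3 k W u))" for W
  define w where "w = real (card ?\<Omega>)"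
  define m where "m = real (card ?U)"
  define v where "v = real (card ?V)"
  have v: "v > 0" by (simp add: v_def card_cartesian_product card_vecs)
  have w: "w \<ge> 0" and m: "m \<ge> 0" by (simp_all add: w_def m_def)
  have R: "(\<Sum>p\<in>?V. ?\<chi> p) = \<eta> * v" using \<eta> by (simp add: v_def)
  have "\<eta> * v \<ge> 0" unfolding R[symmetric] by (intro sum_nonneg) auto
  then have \<eta>0: "\<eta> \<ge> 0" using v by (simp add: zero_le_mult_iff)
  have single: "(\<Sum>W\<in>?\<Omega>. ?\<chi> (lin3 k W u)) = w * \<eta>" if "u \<in> ?U" for u
  proof -
    have "v * (\<Sum>W\<in>?\<Omega>. ?\<chi> (lin3 k W u)) = w * (\<eta> * v)"
      unfolding v_def w_def R[unfolded v_def, symmetric]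
      by (rule lin3_uniform) (use that in \<open>simp add: nonzero_def\<close>)
    then have "v * (\<Sum>W\<in>?\<Omega>. ?\<chi> (lin3 k W u)) = v * (w * \<eta>)" by (simp only: mult_ac)
    moreover have "v \<noteq> 0" using v by simp
    ultimately show ?thesis by (simp only: mult_cancel_left) simp
  qed
  have pair: "(\<Sum>W\<in>?\<Omega>. ?\<chi> (lin3 k W u) * ?\<chi> (lin3 k W u')) = w * \<eta>\<^sup>2"
    if "u \<in> ?U" "u' \<in> ?U" "u \<noteq> u'" for u u'
  proof -
    have "v\<^sup>2 * (\<Sum>W\<in>?\<Omega>. ?\<chi> (lin3 k W u) * ?\<chi> (lin3 k W u')) = w * (\<Sum>p\<in>?V. \<Sum>q\<in>?V. ?\<chi> p * ?\<chi> q)"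
      unfolding v_def w_def by (rule lin3_pair_uniform) (use that in \<open>simp_all add: nonzero_def\<close>)
    also have "(\<Sum>p\<in>?V. \<Sum>q\<in>?V. ?\<chi> p * ?\<chi> q) = (\<eta> * v) * (\<eta> * v)"
      unfolding R[symmetric] sum_product ..
    finally have "v\<^sup>2 * (\<Sum>W\<in>?\<Omega>. ?\<chi> (lin3 k W u) * ?\<chi> (lin3 k W u')) = v\<^sup>2 * (w * \<eta>\<^sup>2)"
      by (simp only: power2_eq_square mult_ac)
    moreover have "v\<^sup>2 \<noteq> 0" using v by simp
    ultimately show ?thesis by (simp only: mult_cancel_left) simp
  qed
  have first: "(\<Sum>W\<in>?\<Omega>. Z W) = m * w * \<eta>"
    unfolding Z_def by (subst sum.swap) (simp only: single sum_constant m_def mult.assoc cong: sum.cong)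
  \<comment> \<open>A diagonal term has mean \<eta> because the indicator is idempotent; an
    off-diagonal term has mean \<open>\<eta>\<^sup>2\<close> by pairwise independence.\<close>
  have second: "(\<Sum>W\<in>?\<Omega>. Z W * Z W) = m * (w * \<eta> + (m - 1) * (w * \<eta>\<^sup>2))"
  proof -
    have "(\<Sum>W\<in>?\<Omega>. Z W * Z W) = (\<Sum>W\<in>?\<Omega>. \<Sum>u\<in>?U. \<Sum>u'\<in>?U. ?\<chi> (lin3 k W u) * ?\<chi> (lin3 k W u'))"
      by (simp only: Z_def sum_product)
    also have "\<dots> = (\<Sum>u\<in>?U. \<Sum>W\<in>?\<Omega>. \<Sum>u'\<in>?U. ?\<chi> (lin3 k W u) * ?\<chi> (lin3 k W u'))"
      by (rule sum.swap)
    also have "\<dots> = (\<Sum>u\<in>?U. \<Sum>u'\<in>?U. \<Sum>W\<in>?\<Omega>. ?\<chi> (lin3 k W u) * ?\<chi> (lin3 k W u'))"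
      by (intro sum.cong refl sum.swap)
    also have "\<dots> = (\<Sum>u\<in>?U. w * \<eta> + (m - 1) * (w * \<eta>\<^sup>2))"
    proof (rule sum.cong[OF refl])
      fix u assume u: "u \<in> ?U"
      have idem: "?\<chi> p * ?\<chi> p = ?\<chi> p" for p by (simp add: of_bool_def)
      have "(\<Sum>u'\<in>?U. \<Sum>W\<in>?\<Omega>. ?\<chi> (lin3 k W u) * ?\<chi> (lin3 k W u'))
        = (\<Sum>W\<in>?\<Omega>. ?\<chi> (lin3 k W u) * ?\<chi> (lin3 k W u))
          + (\<Sum>u'\<in>?U - {u}. \<Sum>W\<in>?\<Omega>. ?\<chi> (lin3 k W u) * ?\<chi> (lin3 k W u'))"
        by (rule sum.remove[OF finite_nonzero u])
      also have "(\<Sum>W\<in>?\<Omega>. ?\<chi> (lin3 k W u) * ?\<chi> (lin3 k W u)) = w * \<eta>"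
        unfolding idem by (rule single[OF u])
      also have "(\<Sum>u'\<in>?U - {u}. \<Sum>W\<in>?\<Omega>. ?\<chi> (lin3 k W u) * ?\<chi> (lin3 k W u')) = (\<Sum>u'\<in>?U - {u}. w * \<eta>\<^sup>2)"
        using pair[OF u] by (intro sum.cong refl) blast
      also have "\<dots> = (m - 1) * (w * \<eta>\<^sup>2)"
      proof -
        have "card ?U \<ge> 1" using u finite_nonzero[of k] by (metis One_nat_def Suc_leI card_gt_0_iff empty_iff)
        then show ?thesis using u finite_nonzero[of k] by (simp add: m_def of_nat_diff)
      qed
      finally show "(\<Sum>u'\<in>?U. \<Sum>W\<in>?\<Omega>. ?\<chi> (lin3 k W u) * ?\<chi> (lin3 k W u')) = w * \<eta> + (m - 1) * (w * \<eta>\<^sup>2)" .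
    qed
    finally show ?thesis by (simp add: m_def)
  qed
  let ?bad = "\<lambda>W. of_bool (Z W < \<eta> * m / 2) :: real"
  \<comment> \<open>Markov's inequality for the squared deviation from the mean
    \<open>\<eta> * m\<close>; the variance is at most this mean.\<close>
  have "(\<eta> * m / 2)\<^sup>2 * (\<Sum>W\<in>?\<Omega>. ?bad W) = (\<Sum>W\<in>?\<Omega>. (\<eta> * m / 2)\<^sup>2 * ?bad W)"
    by (rule sum_distrib_left)
  also have "\<dots> \<le> (\<Sum>W\<in>?\<Omega>. (Z W - \<eta> * m)\<^sup>2)"
  proof (rule sum_mono)
    fix W
    have "(\<eta> * m / 2)\<^sup>2 \<le> (Z W - \<eta> * m)\<^sup>2" if "Z W < \<eta> * m / 2"
    proof -
      have "(\<eta> * m / 2)\<^sup>2 \<le> (\<eta> * m - Z W)\<^sup>2"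
        using that \<eta>0 m by (intro power_mono) auto
      then show ?thesis by (simp add: power2_commute)
    qed
    then show "(\<eta> * m / 2)\<^sup>2 * ?bad W \<le> (Z W - \<eta> * m)\<^sup>2" by auto
  qed
  also have "\<dots> = (\<Sum>W\<in>?\<Omega>. Z W * Z W - 2 * (\<eta> * m) * Z W + (\<eta> * m)\<^sup>2)"
    by (simp add: power2_eq_square algebra_simps)
  also have "\<dots> = (\<Sum>W\<in>?\<Omega>. Z W * Z W) - 2 * (\<eta> * m) * (\<Sum>W\<in>?\<Omega>. Z W) + w * (\<eta> * m)\<^sup>2"
    by (simp add: sum.distrib sum_subtractf sum_distrib_left w_def)
  also have "\<dots> = w * m * \<eta> - w * m * \<eta>\<^sup>2"
    unfolding first second by (simp add: power2_eq_square algebra_simps)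
  also have "\<dots> \<le> (\<eta> * m) * w" using w m by (simp add: mult_ac)
  finally have fin: "(\<eta> * m) * (\<eta> * m * (\<Sum>W\<in>?\<Omega>. ?bad W)) \<le> (\<eta> * m) * (4 * w)"
    by (simp add: power2_eq_square)
  have "\<eta> * m * (\<Sum>W\<in>?\<Omega>. ?bad W) \<le> 4 * w"
  proof (cases "\<eta> * m = 0")
    case True
    show ?thesis unfolding True using w by simp
  next
    case False
    then have "\<eta> * m > 0" using \<eta>0 m by (metis less_le mult_nonneg_nonneg)
    then show ?thesis using fin by (metis mult_left_le_imp_le)
  qed
  then show ?thesis by (simp only: Z_def m_def w_def)
qed

text \<open>Each image of a nonzero vector is uniform on \<open>vecs d\<close> and hence zero with
  probability \<open>1 / 2 ^ d\<close>; a union bound runs over the seven selectors and all nonzero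
  vectors. Outside this event all seven sampling maps are injective.\<close>

lemma singular_bound:
  "2 ^ d * (\<Sum>W\<in>triples (mats k d). of_bool (\<exists>s\<in>selectors. \<exists>u\<in>nonzero k. lin k (select s W) u = 0))
    \<le> 7 * real (card (nonzero k)) * card (triples (mats k d))"
proof -
  let ?\<Omega> = "triples (mats k d)"
  have union: "of_bool (\<exists>s\<in>selectors. \<exists>u\<in>nonzero k. lin k (select s W) u = 0)
     \<le> (\<Sum>r\<in>selectors \<times> nonzero k. of_bool (lin k (select (fst r) W) (snd r) = 0) :: real)" for W
  proof -
    have "(\<exists>s\<in>selectors. \<exists>u\<in>nonzero k. lin k (select s W) u = 0)
      = (\<exists>r\<in>selectors \<times> nonzero k. lin k (select (fst r) W) (snd r) = 0)" by auto
    then show ?thesis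
      using of_bool_Bex_le_sum[of "selectors \<times> nonzero k" "\<lambda>r. lin k (select (fst r) W) (snd r) = 0"]
      by (simp only: finite_cartesian_product finite_selectors finite_nonzero)
  qed
  have "2 ^ d * (\<Sum>W\<in>?\<Omega>. of_bool (\<exists>s\<in>selectors. \<exists>u\<in>nonzero k. lin k (select s W) u = 0))
      \<le> 2 ^ d * (\<Sum>W\<in>?\<Omega>. \<Sum>r\<in>selectors \<times> nonzero k. of_bool (lin k (select (fst r) W) (snd r) = 0) :: real)"
    by (intro mult_left_mono sum_mono union) auto
  also have "\<dots> = (\<Sum>r\<in>selectors \<times> nonzero k. 2 ^ d * (\<Sum>W\<in>?\<Omega>. of_bool (lin k (select (fst r) W) (snd r) = 0)))"
    by (subst sum.swap) (simp only: sum_distrib_left)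
  also have "\<dots> = (\<Sum>r\<in>selectors \<times> nonzero k. real (card ?\<Omega>))"
  proof (rule sum.cong[OF refl])
    fix r assume r: "r \<in> selectors \<times> nonzero k"
    have "2 ^ d * (\<Sum>W\<in>?\<Omega>. of_bool (lin k (select (fst r) W) (snd r) = 0))
        = real (card ?\<Omega>) * (\<Sum>x\<in>vecs d. of_bool (x = 0))"
      using r by (intro lin_uniform[where \<phi> = "\<lambda>x. of_bool (x = 0)"]) (auto simp: nonzero_def)
    also have "(\<Sum>x\<in>vecs d. of_bool (x = 0)) = real (card {0 :: nat \<Rightarrow> bit})"
      using finite_subgroupD(1,2)[OF finite_subgroup_vecs, of d]
      by (subst sum_of_bool_eq) (auto intro!: arg_cong[where f = card])
    finally show "2 ^ d * (\<Sum>W\<in>?\<Omega>. of_bool (lin k (select (fst r) W) (snd r) = 0)) = real (card ?\<Omega>)"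
      by (simp only: card.insert finite.emptyI card.empty) simp
  qed
  also have "\<dots> = 7 * real (card (nonzero k)) * card ?\<Omega>"
    by (simp add: card_cartesian_product card_selectors)
  finally show ?thesis .
qed

section \<open>The sample space and the points it queries\<close>

definition samples :: "nat \<Rightarrow> ((bool \<times> bool \<times> bool) \<times> (nat \<Rightarrow> bit)) set" where
  "samples k = selectors \<times> nonzero k"

definition point where
  "point k W p = lin k (select (fst p) W) (snd p)"

lemma finite_samples: "finite (samples k)" and card_samples: "card (samples k) = 7 * card (nonzero k)"
  by (simp_all add: samples_def finite_selectors finite_nonzero card_cartesian_product card_selectors)

text \<open>The seven maps have trivial kernel, so each of them sends at most one vector to a given
  erased point.\<close>

lemma fibre_bound:
  assumes W: "W \<in> triples (mats k d)"
    and reg: "\<not> (\<exists>s\<in>selectors. \<exists>u\<in>nonzero k. lin k (select s W) u = 0)"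
    and E: "finite E"
  shows "card {p \<in> samples k. to_list d (point k W p) \<in> E} \<le> 7 * card E"
proof -
  define S where "S s = {u \<in> nonzero k. to_list d (lin k (select s W) u) \<in> E}" for s
  have "{p \<in> samples k. to_list d (point k W p) \<in> E} = Sigma selectors S"
    by (auto simp: samples_def point_def S_def)
  then have "card {p \<in> samples k. to_list d (point k W p) \<in> E} = (\<Sum>s\<in>selectors. card (S s))"
    by (simp add: card_SigmaI finite_selectors S_def finite_nonzero)
  also have "\<dots> \<le> (\<Sum>s\<in>selectors. card E)"
  proof (rule sum_mono)
    fix s assume s: "s \<in> selectors"
    have X: "select s W \<in> mats k d" by (rule select_mem[OF finite_subgroup_mats W])
    have "inj_on (\<lambda>u. to_list d (lin k (select s W) u)) (S s)"
    proof
      fix u v assume u: "u \<in> S s" and v: "v \<in> S s"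
        and eq: "to_list d (lin k (select s W) u) = to_list d (lin k (select s W) v)"
      have "lin k (select s W) u = lin k (select s W) v"
        using of_list_to_list[OF lin_mem[OF X]] eq by metis
      then have "lin k (select s W) (u + v) = 0" by (simp add: lin_add_right)
      moreover have "u + v \<in> vecs k"
        using u v finite_subgroupD(3)[OF finite_subgroup_vecs] by (auto simp: S_def nonzero_def)
      ultimately have "u + v = 0" using reg s by (auto simp: nonzero_def)
      then show "u = v" by (simp only: add_eq_0_iff_eq)
    qed
    then show "card (S s) \<le> card E"
      using E by (intro card_inj_on_le[of "\<lambda>u. to_list d (lin k (select s W) u)"]) (auto simp: S_def)
  qed
  finally show ?thesis by (simp add: card_selectors)
qed

text \<open>Quadratic functions as the tester sees them for fixed \<open>W\<close>. The use of
  \<open>restrict\<close> identifies functions that agree on all samples, which makes the family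
  finite.\<close>

definition pullbacks where
  "pullbacks k d W = (\<lambda>G. restrict (\<lambda>p. G (point k W p)) (samples k)) `
     {G. \<forall>p\<in>triples (vecs d). seven_sum G p = 0}"

lemma qform_cong:
  "(\<And>i. i < n \<Longrightarrow> a i = a' i) \<Longrightarrow> (\<And>i j. i < n \<Longrightarrow> j < n \<Longrightarrow> b i j = b' i j) \<Longrightarrow>
    qform n a b v = qform n a' b' v"
  by (simp add: qform_def)

lemma seven_sum_lin:
  assumes "\<forall>p\<in>triples (vecs d). seven_sum G p = 0" and X: "X \<in> mats k d"
  shows "seven_sum (\<lambda>u. G (lin k X u)) p = 0"
proof -
  obtain x y z where p: "p = (x, y, z)" by (metis prod_cases3)
  have "seven_sum G (lin k X x, lin k X y, lin k X z) = 0"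
    using assms by (auto simp: lin_mem)
  then show ?thesis by (simp add: p seven_sum_eq lin_add_right)
qed

text \<open>Along each of the seven maps a quadratic function becomes a form in \<open>k\<close>
  variables with \<open>k + k * k\<close> coefficients. The resulting bound is independent of
  \<open>d\<close>.\<close>

lemma pullbacks_card:
  assumes W: "W \<in> triples (mats k d)"
  shows "finite (pullbacks k d W)" and "card (pullbacks k d W) \<le> 2 ^ (7 * (k + k * k))"
proof -
  let ?B = "PiE {..<k} (\<lambda>_. vecs k)"
  let ?C = "PiE selectors (\<lambda>_. vecs k \<times> ?B)"
  let ?h = "\<lambda>c. restrict (\<lambda>p. qform k (fst (c (fst p))) (snd (c (fst p))) (snd p)) (samples k)"
  have fin: "finite ?C"
    using finite_subgroupD(1)[OF finite_subgroup_vecs] by (auto intro!: finite_PiE finite_selectors)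
  have card: "card ?C = 2 ^ (7 * (k + k * k))"
    by (simp add: card_PiE finite_selectors card_selectors card_cartesian_product card_vecs
        flip: power_mult power_add)
  have sub: "pullbacks k d W \<subseteq> ?h ` ?C"
  proof
    fix h assume "h \<in> pullbacks k d W"
    then obtain G where G: "\<forall>p\<in>triples (vecs d). seven_sum G p = 0"
      and h: "h = restrict (\<lambda>p. G (point k W p)) (samples k)"
      by (auto simp: pullbacks_def)
    have "\<forall>s. \<exists>r \<in> vecs k \<times> ?B. \<forall>u\<in>vecs k. G (lin k (select s W) u) = qform k (fst r) (snd r) u"
    proof
      fix s
      obtain a b where ab: "\<forall>u\<in>vecs k. G (lin k (select s W) u) = qform k a b u"
        using qform_expansion[of k "\<lambda>u. G (lin k (select s W) u)"]
          seven_sum_lin[OF G select_mem[OF finite_subgroup_mats W]] by blast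
      \<comment> \<open>Coefficients with an index outside the range are normalised, so that the
        pair lies in the finite set being counted.\<close>
      define a' where "a' i = (if i < k then a i else 0)" for i
      define b' where "b' = restrict (\<lambda>i j. if j < k then b i j else 0) {..<k}"
      have "a' \<in> vecs k" "b' \<in> ?B" by (auto simp: a'_def b'_def vecs_def)
      moreover have "qform k a b u = qform k a' b' u" for u
        by (rule qform_cong) (auto simp: a'_def b'_def)
      ultimately show "\<exists>r \<in> vecs k \<times> ?B. \<forall>u\<in>vecs k. G (lin k (select s W) u) = qform k (fst r) (snd r) u"
        using ab by (intro bexI[of _ "(a', b')"]) auto
    qed
    then obtain c where c: "\<And>s. c s \<in> vecs k \<times> ?B"
      "\<And>s u. u \<in> vecs k \<Longrightarrow> G (lin k (select s W) u) = qform k (fst (c s)) (snd (c s)) u"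
      by metis
    have "h = ?h (restrict c selectors)"
      unfolding h by (rule restrict_ext) (auto simp: samples_def point_def c(2) nonzero_def)
    moreover have "restrict c selectors \<in> ?C" using c(1) by auto
    ultimately show "h \<in> ?h ` ?C" by blast
  qed
  show "finite (pullbacks k d W)" using finite_subset[OF sub] fin by blast
  have "card (pullbacks k d W) \<le> card (?h ` ?C)" using fin by (intro card_mono sub) auto
  also have "\<dots> \<le> card ?C" by (rule card_image_le[OF fin])
  finally show "card (pullbacks k d W) \<le> 2 ^ (7 * (k + k * k))" by (simp only: card)
qed

text \<open>Where two pullbacks differ, their sum along that selector is a nonzero solution of the
  identity on \<open>vecs k\<close>. By \<open>seven_sum_density\<close> it is nonzero on at least
  1/6 of that slice, and the slice is 1/7 of the samples; hence 42.\<close>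

lemma pullbacks_separated:
  assumes W: "W \<in> triples (mats k d)" and h: "h \<in> pullbacks k d W" "h' \<in> pullbacks k d W" "h \<noteq> h'"
  shows "card (samples k) \<le> 42 * card {p \<in> samples k. h p \<noteq> h' p}"
proof -
  obtain G G' where G: "\<forall>p\<in>triples (vecs d). seven_sum G p = 0" "\<forall>p\<in>triples (vecs d). seven_sum G' p = 0"
    and hG: "h = restrict (\<lambda>p. G (point k W p)) (samples k)" "h' = restrict (\<lambda>p. G' (point k W p)) (samples k)"
    using h(1,2) by (auto simp: pullbacks_def)
  obtain p where p: "p \<in> samples k" "h p \<noteq> h' p"
    using h(3) unfolding hG by (metis (no_types, lifting) restrict_ext restrict_apply')
  obtain s u where su: "p = (s, u)" by (cases p)
  have s: "s \<in> selectors" and u: "u \<in> nonzero k" using p(1) su by (auto simp: samples_def)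
  let ?X = "select s W"
  have X: "?X \<in> mats k d" by (rule select_mem[OF finite_subgroup_mats W])
  define \<phi> where "\<phi> v = G (lin k ?X v) + G' (lin k ?X v)" for v
  have zero: "seven_sum \<phi> q = 0" for q
    using seven_sum_lin[OF G(1) X] seven_sum_lin[OF G(2) X]
    by (simp add: \<phi>_def seven_sum_def sum.distrib)
  have "\<phi> u \<noteq> 0"
    using p su unfolding hG \<phi>_def by (auto simp: point_def add_eq_0_iff_eq)
  then have "card (vecs k) \<le> 6 * card {v \<in> vecs k. \<phi> v \<noteq> 0}"
    using u by (intro seven_sum_density[OF finite_subgroup_vecs zero]) (auto simp: nonzero_def)
  also have "{v \<in> vecs k. \<phi> v \<noteq> 0} = {v \<in> nonzero k. \<phi> v \<noteq> 0}"
  proof -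
    \<comment> \<open>The samples leave out the zero vector, but no disagreement is lost
      there.\<close>
    have "\<phi> 0 = 0" using zero[of "(0, 0, 0)"] by (simp add: seven_sum_eq)
    then show ?thesis unfolding nonzero_def by blast
  qed
  also have "card {v \<in> nonzero k. \<phi> v \<noteq> 0} = card (Pair s ` {v \<in> nonzero k. \<phi> v \<noteq> 0})"
    by (simp add: card_image inj_on_def)
  also have "\<dots> \<le> card {p \<in> samples k. h p \<noteq> h' p}"
  proof (rule card_mono)
    show "finite {p \<in> samples k. h p \<noteq> h' p}" using finite_samples by simp
    show "Pair s ` {v \<in> nonzero k. \<phi> v \<noteq> 0} \<subseteq> {p \<in> samples k. h p \<noteq> h' p}"
      using s by (auto simp: samples_def hG \<phi>_def point_def add_eq_0_iff_eq)
  qed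
  finally have "card (vecs k) \<le> 6 * card {p \<in> samples k. h p \<noteq> h' p}" by simp
  moreover have "card (nonzero k) \<le> card (vecs k)"
    using finite_subgroupD(1)[OF finite_subgroup_vecs] by (intro card_mono) (auto simp: nonzero_def)
  ultimately show ?thesis by (simp add: card_samples)
qed

text \<open>\<open>G\<close> satisfies the identity, so a violated triple has a partial sum where
  \<open>F\<close> and \<open>G\<close> differ. Distinct \<open>u\<close> give distinct
  samples.\<close>

lemma pullbacks_disagree:
  assumes W: "W \<in> triples (mats k d)" and h: "h \<in> pullbacks k d W"
  shows "(\<Sum>u\<in>nonzero k. of_bool (seven_sum F (lin3 k W u) \<noteq> 0))
    \<le> real (card {p \<in> samples k. F (point k W p) \<noteq> h p})"
proof -
  obtain G where G: "\<forall>p\<in>triples (vecs d). seven_sum G p = 0"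
    and hG: "h = restrict (\<lambda>p. G (point k W p)) (samples k)"
    using h by (auto simp: pullbacks_def)
  let ?Z = "{u \<in> nonzero k. seven_sum F (lin3 k W u) \<noteq> 0}"
  have "?Z \<subseteq> snd ` {p \<in> samples k. F (point k W p) \<noteq> h p}"
  proof
    fix u assume u: "u \<in> ?Z"
    have "seven_sum G (lin3 k W u) = 0" using G lin3_mem[OF W] by blast
    then have "seven_sum F (lin3 k W u) \<noteq> seven_sum G (lin3 k W u)" using u by simp
    then have "\<not> (\<forall>s\<in>selectors. F (select s (lin3 k W u)) = G (select s (lin3 k W u)))"
      unfolding seven_sum_def by (auto intro: sum.cong)
    then obtain s where s: "s \<in> selectors" "F (select s (lin3 k W u)) \<noteq> G (select s (lin3 k W u))"
      by blast
    then show "u \<in> snd ` {p \<in> samples k. F (point k W p) \<noteq> h p}"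
      using u by (intro image_eqI[of _ _ "(s, u)"]) (auto simp: hG samples_def point_def select_lin3)
  qed
  then have "card ?Z \<le> card (snd ` {p \<in> samples k. F (point k W p) \<noteq> h p})"
    by (intro card_mono) (auto simp: finite_samples)
  also have "\<dots> \<le> card {p \<in> samples k. F (point k W p) \<noteq> h p}"
    by (intro card_image_le) (auto simp: finite_samples)
  finally show ?thesis
    using finite_nonzero[of k] by (simp add: Int_def)
qed

section \<open>The tester\<close>

text \<open>An erased answer imposes no constraint, so a quadratic input is its own witness for
  acceptance, whatever is erased.\<close>

definition decide :: "nat \<Rightarrow> bool list list \<Rightarrow> bool option list \<Rightarrow> bool" where
  "decide d qs ans \<longleftrightarrow> (\<exists>g. quadratic d g \<and> list_all2 (\<lambda>x a. a = None \<or> a = Some (g x)) qs ans)"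

definition queries where
  "queries k d W us = map (\<lambda>p. to_list d (point k W p)) us"

definition quad_tester :: "nat \<Rightarrow> nat \<Rightarrow> nat \<Rightarrow> tester" where
  "quad_tester k N d = map_pmf (\<lambda>(W, us). (queries k d W us, decide d (queries k d W us)))
     (pmf_of_set (triples (mats k d) \<times> words (samples k) N))"

lemma run_aux_consistent:
  "\<exists>ans. map snd (run_aux f A E h xs) = map snd h @ ans \<and>
     list_all2 (\<lambda>x a. a = None \<or> a = Some (f x)) xs ans"
proof (induction xs arbitrary: E h)
  case (Cons x xs)
  define a where "a = (if x \<in> E then None else Some (f x))"
  obtain ans where "map snd (run_aux f A (E \<union> A (h @ [(x, a)])) (h @ [(x, a)]) xs) = map snd (h @ [(x, a)]) @ ans"
    "list_all2 (\<lambda>x a. a = None \<or> a = Some (f x)) xs ans"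
    using Cons.IH by blast
  then show ?case
    by (intro exI[of _ "a # ans"]) (auto simp: Let_def a_def)
qed auto

lemma decide_quadratic: "quadratic d f \<Longrightarrow> decide d qs (oracle_answers f A qs)"
  using run_aux_consistent[of f A "{}" "[]" qs] by (auto simp: decide_def oracle_answers_def)

lemma finite_coins: "finite (triples (mats k d) \<times> words (samples k) N)"
  by (intro finite_cartesian_product finite_words finite_samples finite_subgroupD(1)[OF finite_subgroup_mats])

lemma coins_nonempty:
  assumes "k \<ge> 1"
  shows "triples (mats k d) \<times> words (samples k) N \<noteq> {}"
proof -
  have "real (card (nonzero k)) > 0"
    using assms by (simp add: card_nonzero)
  then have "card (words (samples k) N) > 0"
    by (simp add: card_words finite_samples card_samples)
  then have "words (samples k) N \<noteq> {}" by auto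
  then show ?thesis using finite_subgroupD(2)[OF finite_subgroup_mats] by blast
qed

lemma set_quad_tester:
  assumes "k \<ge> 1" and "(qs, dec) \<in> set_pmf (quad_tester k N d)"
  shows "set qs \<subseteq> cube d" "length qs = N" "dec = decide d qs"
  using assms finite_coins coins_nonempty[OF assms(1)]
  by (auto simp: quad_tester_def set_pmf_of_set words_def queries_def to_list_mem)

lemma quad_tester_complete:
  assumes "k \<ge> 1" "quadratic d f"
  shows "accept_prob (quad_tester k N d) f A = 1"
proof -
  have "dec (oracle_answers f A qs)" if "(qs, dec) \<in> set_pmf (quad_tester k N d)" for qs dec
    using set_quad_tester(3)[OF assms(1) that] decide_quadratic[OF assms(2)] by simp
  then show ?thesis
    unfolding accept_prob_def by (subst measure_pmf.prob_eq_1) (auto simp: AE_measure_pmf_iff)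
qed

lemma accept_prob_quad_tester:
  assumes "k \<ge> 1"
  shows "card (triples (mats k d)) * card (samples k) ^ N * accept_prob (quad_tester k N d) f A
    = (\<Sum>W\<in>triples (mats k d). \<Sum>us\<in>words (samples k) N.
        of_bool (decide d (queries k d W us) (oracle_answers f A (queries k d W us))))"
proof -
  let ?S = "triples (mats k d) \<times> words (samples k) N"
  let ?acc = "\<lambda>r. decide d (queries k d (fst r) (snd r)) (oracle_answers f A (queries k d (fst r) (snd r)))"
  have S: "finite ?S" "?S \<noteq> {}" using finite_coins coins_nonempty[OF assms] by blast+
  have "accept_prob (quad_tester k N d) f A = measure_pmf.prob (pmf_of_set ?S) {r. ?acc r}"
    unfolding accept_prob_def quad_tester_def
    by (simp add: measure_map_pmf case_prod_beta vimage_def)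
  also have "\<dots> = card (?S \<inter> {r. ?acc r}) / card ?S"
    by (rule measure_pmf_of_set[OF S(2,1)])
  also have "real (card (?S \<inter> {r. ?acc r})) = (\<Sum>r\<in>?S. of_bool (?acc r))"
    using S(1) by simp
  also have "\<dots> = (\<Sum>W\<in>triples (mats k d). \<Sum>us\<in>words (samples k) N.
        of_bool (decide d (queries k d W us) (oracle_answers f A (queries k d W us))))"
    by (subst sum.cartesian_product') simp
  finally have eq: "accept_prob (quad_tester k N d) f A = (\<Sum>W\<in>triples (mats k d). \<Sum>us\<in>words (samples k) N.
        of_bool (decide d (queries k d W us) (oracle_answers f A (queries k d W us)))) / card ?S" .
  have "card ?S = card (triples (mats k d)) * card (samples k) ^ N"
    by (simp add: card_words finite_samples card_cartesian_product)
  moreover have "card ?S \<noteq> 0" using S by simp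
  ultimately show ?thesis unfolding eq by (simp only: times_divide_eq_right) simp
qed

text \<open>Without erasures, the witness for acceptance agrees with \<open>f\<close> at every
  query, and its pullback belongs to the family to which \<open>consistent_bound\<close>
  applies.\<close>

lemma decide_imp_pullback:
  assumes W: "W \<in> triples (mats k d)" and us: "us \<in> words (samples k) N"
    and dec: "decide d (queries k d W us) (oracle_answers f A (queries k d W us))"
    and un: "unerased f A {} [] (queries k d W us)"
  shows "\<exists>h\<in>pullbacks k d W. \<forall>p\<in>set us. of_bool (f (to_list d (point k W p))) = h p"
proof -
  obtain g where g: "quadratic d g"
    and "list_all2 (\<lambda>x a. a = None \<or> a = Some (g x)) (queries k d W us)
      (map (\<lambda>x. Some (f x)) (queries k d W us))"
    using dec un by (auto simp: decide_def oracle_answers_unerased)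
  then have fg: "\<forall>x\<in>set (queries k d W us). f x = g x"
    by (auto simp: list_all2_map2 list_all2_same)
  let ?G = "\<lambda>v. of_bool (g (to_list d v)) :: bit"
  have "restrict (\<lambda>p. ?G (point k W p)) (samples k) \<in> pullbacks k d W"
    unfolding pullbacks_def using quadratic_seven_sum[OF g] by (intro imageI) blast
  moreover have "\<forall>p\<in>set us. of_bool (f (to_list d (point k W p))) = restrict (\<lambda>p. ?G (point k W p)) (samples k) p"
    using fg us by (auto simp: queries_def words_def)
  ultimately show ?thesis by blast
qed

text \<open>The five terms account for too few violated triples, a singular map, an erased query,
  the one pullback that may be close to \<open>f\<close>, and all other pullbacks. The constants are
  136 = 4 * 34, 476 = 14 * 34 and 84 = 2 * 42.\<close>

lemma quad_tester_sound:
  assumes k: "k \<ge> 1" and eps: "0 < eps" "eps < 1"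
    and far: "far_from_quadratic d eps f" and A: "valid_adversary d t A"
  shows "accept_prob (quad_tester k N d) f A \<le> 136 / (eps * (2 ^ k - 1)) + 7 * (2 ^ k - 1) / 2 ^ d
    + t * real N ^ 2 / (2 ^ k - 1) + (1 - eps / 476) ^ N + 2 ^ (7 * (k + k * k)) * (83 / 84) ^ N"
proof -
  let ?\<Omega> = "triples (mats k d)" and ?U = "nonzero k" and ?P = "samples k"
  let ?F = "\<lambda>v. of_bool (f (to_list d v)) :: bit"
  define m where "m = real (card ?U)"
  define M where "M = real (card ?P)"
  define w where "w = real (card ?\<Omega>)"
  have m_eq: "m = 2 ^ k - 1" by (simp add: m_def card_nonzero)
  have "(2::real) ^ k \<ge> 2 ^ 1" using k by (intro power_increasing) auto
  then have m: "m > 0" by (simp add: m_eq)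
  have M: "M = 7 * m" "M > 0" using m by (simp_all add: M_def m_def card_samples)
  have w: "w > 0"
    using finite_subgroupD(4)[OF finite_subgroup_mats, of k d] by (simp add: w_def card_cartesian_product)
  define v where "v = real (card (triples (vecs d)))"
  have v: "v > 0" by (simp add: v_def card_cartesian_product card_vecs)
  define \<eta> where "\<eta> = violations (vecs d) ?F / v"
  have \<eta>v: "violations (vecs d) ?F = \<eta> * v" using v by (simp add: \<eta>_def)
  have "eps / 34 * v \<le> \<eta> * v"
    using far_violations[OF far eps] \<eta>v by (simp add: v_def)
  then have \<eta>_ge: "eps / 34 \<le> \<eta>" using v by simp
  then have \<eta>_pos: "\<eta> > 0" using eps by simp
  let ?sparse = "\<lambda>W. (\<Sum>u\<in>?U. of_bool (seven_sum ?F (lin3 k W u) \<noteq> 0)) < \<eta> * m / 2"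
  let ?sing = "\<lambda>W. \<exists>s\<in>selectors. \<exists>u\<in>?U. lin k (select s W) u = 0"
  let ?acc = "\<lambda>W us. decide d (queries k d W us) (oracle_answers f A (queries k d W us))"
  define e where "e = t * real N ^ 2 / m"
  define c where "c = (1 - eps / 476) ^ N + 2 ^ (7 * (k + k * k)) * (83 / 84) ^ N"
  have e0: "e \<ge> 0" using m by (simp add: e_def)
  have c0: "c \<ge> 0" using eps by (simp add: c_def)
  have each: "(\<Sum>us\<in>words ?P N. of_bool (?acc W us))
     \<le> (of_bool (?sparse W) + of_bool (?sing W) + (e + c)) * M ^ N" if W: "W \<in> ?\<Omega>" for W
  proof (cases "?sparse W \<or> ?sing W")
    case True
    have "(\<Sum>us\<in>words ?P N. of_bool (?acc W us)) \<le> (\<Sum>us\<in>words ?P N. 1 :: real)"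
      by (intro sum_mono) auto
    also have "\<dots> = 1 * M ^ N" by (simp add: card_words finite_samples M_def)
    also have "\<dots> \<le> (of_bool (?sparse W) + of_bool (?sing W) + (e + c)) * M ^ N"
      using True e0 c0 M by (intro mult_right_mono) auto
    finally show ?thesis .
  next
    case False
    have "(\<Sum>us\<in>words ?P N. of_bool (?acc W us)) \<le> (\<Sum>us\<in>words ?P N.
        of_bool (\<not> unerased f A {} [] (map (\<lambda>p. to_list d (point k W p)) us))
        + of_bool (\<exists>h\<in>pullbacks k d W. \<forall>p\<in>set us. ?F (point k W p) = h p) :: real)"
    proof (rule sum_mono)
      fix us assume "us \<in> words ?P N"
      then show "of_bool (?acc W us) \<le>
        (of_bool (\<not> unerased f A {} [] (map (\<lambda>p. to_list d (point k W p)) us))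
        + of_bool (\<exists>h\<in>pullbacks k d W. \<forall>p\<in>set us. ?F (point k W p) = h p) :: real)"
        using decide_imp_pullback[OF W, of us N f A]
        by (cases "unerased f A {} [] (queries k d W us)") (auto simp: queries_def)
    qed
    also have "\<dots> = (\<Sum>us\<in>words ?P N. of_bool (\<not> unerased f A {} [] (map (\<lambda>p. to_list d (point k W p)) us)))
        + (\<Sum>us\<in>words ?P N. of_bool (\<exists>h\<in>pullbacks k d W. \<forall>p\<in>set us. ?F (point k W p) = h p))"
      by (rule sum.distrib)
    also have "\<dots> \<le> e * M ^ N + c * M ^ N"
    proof (rule add_mono)
      have "M * (\<Sum>us\<in>words ?P N. of_bool (\<not> unerased f A {} [] (map (\<lambda>p. to_list d (point k W p)) us)))
          \<le> real N * 7 * real (card ({} :: bool list set) + t * N) * M ^ N"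
        unfolding M_def
      proof (rule erasure_bound[OF finite_samples A])
        fix E :: "bool list set" assume E: "finite E"
        have "card {p \<in> ?P. to_list d (point k W p) \<in> E} \<le> 7 * card E"
          by (rule fibre_bound[OF W _ E]) (use False in blast)
        then show "real (card {p \<in> ?P. to_list d (point k W p) \<in> E}) \<le> 7 * real (card E)" by linarith
      qed auto
      also have "\<dots> = M * (e * M ^ N)"
        using m by (simp add: M e_def power2_eq_square)
      finally show "(\<Sum>us\<in>words ?P N. of_bool (\<not> unerased f A {} [] (map (\<lambda>p. to_list d (point k W p)) us)))
          \<le> e * M ^ N"
        by (rule mult_left_le_imp_le) (rule M)
    next
      have "(\<Sum>us\<in>words ?P N. of_bool (\<exists>h\<in>pullbacks k d W. \<forall>p\<in>set us. ?F (point k W p) = h p))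
          \<le> ((1 - eps / 476) ^ N + card (pullbacks k d W) * (1 - 1 / 84) ^ N) * M ^ N"
        unfolding M_def
      proof (rule consistent_bound[OF finite_samples pullbacks_card(1)[OF W]])
        fix h assume h: "h \<in> pullbacks k d W"
        \<comment> \<open>At least half of the expected \<eta> m violations among 7 m samples gives
          the factor 1/14.\<close>
        have "eps / 476 * M \<le> \<eta> / 14 * M" using \<eta>_ge M by (intro mult_right_mono) auto
        also have "\<dots> = \<eta> * m / 2" by (simp add: M)
        also have "\<dots> \<le> (\<Sum>u\<in>?U. of_bool (seven_sum ?F (lin3 k W u) \<noteq> 0))"
          using False by (simp only: not_less de_Morgan_disj)
        also have "\<dots> \<le> card {p \<in> ?P. ?F (point k W p) \<noteq> h p}"
          by (rule pullbacks_disagree[OF W h])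
        finally show "eps / 476 * card ?P \<le> card {p \<in> ?P. ?F (point k W p) \<noteq> h p}"
          by (simp only: M_def)
      next
        fix h h' assume "h \<in> pullbacks k d W" "h' \<in> pullbacks k d W" "h \<noteq> h'"
        from pullbacks_separated[OF W this]
        show "2 * (1 / 84) * real (card ?P) \<le> card {p \<in> ?P. h p \<noteq> h' p}" by simp
      qed (use eps in auto)
      also have "\<dots> \<le> c * M ^ N"
      proof (rule mult_right_mono)
        have "real (card (pullbacks k d W)) \<le> 2 ^ (7 * (k + k * k))"
          using of_nat_mono[OF pullbacks_card(2)[OF W], where 'a = real] by simp
        then show "(1 - eps / 476) ^ N + card (pullbacks k d W) * (1 - 1 / 84) ^ N \<le> c"
          unfolding c_def by (intro add_mono order.refl mult_mono) auto
      qed (use M in auto)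
      finally show "(\<Sum>us\<in>words ?P N. of_bool (\<exists>h\<in>pullbacks k d W. \<forall>p\<in>set us. ?F (point k W p) = h p))
          \<le> c * M ^ N" .
    qed
    also have "\<dots> \<le> (of_bool (?sparse W) + of_bool (?sing W) + (e + c)) * M ^ N"
      using M by (simp add: distrib_right)
    finally show ?thesis .
  qed
  have "w * M ^ N * accept_prob (quad_tester k N d) f A = (\<Sum>W\<in>?\<Omega>. \<Sum>us\<in>words ?P N. of_bool (?acc W us))"
    using accept_prob_quad_tester[OF k, of d N f A] by (simp add: w_def M_def)
  also have "\<dots> \<le> (\<Sum>W\<in>?\<Omega>. (of_bool (?sparse W) + of_bool (?sing W) + (e + c)) * M ^ N)"
    by (intro sum_mono each)
  also have "\<dots> = ((\<Sum>W\<in>?\<Omega>. of_bool (?sparse W)) + (\<Sum>W\<in>?\<Omega>. of_bool (?sing W)) + w * (e + c)) * M ^ N"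
    by (simp only: sum.distrib sum_constant w_def distrib_left flip: sum_distrib_right)
  also have "\<dots> \<le> (136 / (eps * m) * w + 7 * m / 2 ^ d * w + w * (e + c)) * M ^ N"
  proof (intro mult_right_mono add_mono order.refl)
    have "\<eta> * m * (\<Sum>W\<in>?\<Omega>. of_bool (?sparse W)) \<le> 4 * w"
      using violations_concentrate[OF \<eta>v[unfolded v_def], of k] by (simp only: m_def w_def)
    then have "(\<Sum>W\<in>?\<Omega>. of_bool (?sparse W)) \<le> 4 * w / (\<eta> * m)"
      using \<eta>_pos m by (simp add: pos_le_divide_eq mult_ac)
    also have "\<dots> \<le> 4 * w / (eps / 34 * m)"
      using \<eta>_ge \<eta>_pos eps m w by (intro divide_left_mono mult_right_mono mult_pos_pos) auto
    also have "\<dots> = 136 / (eps * m) * w" using eps m by (simp add: field_simps)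
    finally show "(\<Sum>W\<in>?\<Omega>. of_bool (?sparse W)) \<le> 136 / (eps * m) * w" .
    show "(\<Sum>W\<in>?\<Omega>. of_bool (?sing W)) \<le> 7 * m / 2 ^ d * w"
      using singular_bound[of d k] by (simp add: m_def w_def pos_le_divide_eq mult_ac)
  qed (use M e0 c0 in auto)
  also have "\<dots> = w * M ^ N * (136 / (eps * m) + 7 * m / 2 ^ d + e + c)"
    by (simp add: algebra_simps)
  finally have "accept_prob (quad_tester k N d) f A \<le> 136 / (eps * m) + 7 * m / 2 ^ d + e + c"
    by (rule mult_left_le_imp_le) (use w M in simp)
  then show ?thesis unfolding e_def c_def m_eq by simp
qed

text \<open>With \<open>2 ^ m\<close> queries and \<open>k = 2 * m + a\<close>, the number of
  pullbacks is exponential in a quadratic polynomial of \<open>m\<close>, while the decay is doubly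
  exponential in \<open>m\<close>. The threshold depends on \<open>a\<close> only.\<close>

lemma pullback_term_small:
  "\<exists>m0. \<forall>m\<ge>m0. 2 ^ (7 * ((2 * m + a) + (2 * m + a) * (2 * m + a))) * (83 / 84) ^ (2 ^ m) \<le> (1 / 24 :: real)"
proof -
  have "((\<lambda>m::nat. 2 powr (7 * ((2 * m + real a) + (2 * m + real a) * (2 * m + real a))) * (83 / 84) powr (2 powr m)) \<longlongrightarrow> 0) at_top"
    by real_asymp
  then have "\<forall>\<^sub>F m::nat in at_top. 2 powr (7 * ((2 * m + real a) + (2 * m + real a) * (2 * m + real a))) * (83 / 84) powr (2 powr m) < 1 / 24"
    by (rule order_tendstoD) simp
  then obtain m0 where "\<forall>m\<ge>m0. 2 powr (7 * ((2 * real m + real a) + (2 * real m + real a) * (2 * real m + real a))) * (83 / 84) powr (2 powr real m) < 1 / 24"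
    by (auto simp: eventually_at_top_linorder)
  moreover have "2 powr (7 * ((2 * real m + real a) + (2 * real m + real a) * (2 * real m + real a))) * (83 / 84) powr (2 powr real m)
    = 2 ^ (7 * ((2 * m + a) + (2 * m + a) * (2 * m + a))) * (83 / 84) ^ (2 ^ m)" for m
  proof -
    have "7 * ((2 * real m + real a) + (2 * real m + real a) * (2 * real m + real a)) = real (7 * ((2 * m + a) + (2 * m + a) * (2 * m + a)))"
      by simp
    moreover have "2 powr real m = real (2 ^ m)" by (simp add: powr_realpow)
    moreover have "(83 / 84 :: real) powr real n = (83 / 84) ^ n" for n by (rule powr_realpow) simp
    ultimately show ?thesis by (simp only: powr_realpow zero_less_numeral)
  qed
  ultimately show ?thesis by (auto intro: less_imp_le)
qed

theorem theorem1p4: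
  fixes t :: nat
  shows "\<exists>(C :: real) (d0 :: real \<Rightarrow> nat) (T :: real \<Rightarrow> nat \<Rightarrow> tester).
           \<forall>eps d. 0 < eps \<and> eps < 1 \<and> d \<ge> d0 eps \<longrightarrow>
             online_erasure_quadratic_tester t d eps (C / eps) (T eps d)"
proof -
  \<comment> \<open>Chosen so that \<open>2 ^ a\<close> exceeds \<open>12 * t + 1\<close>, which
    bounds the erasure term by 1/12.\<close>
  define a where "a = 12 * t + 1"
  obtain m0 where m0: "\<And>m. m \<ge> m0 \<Longrightarrow>
      2 ^ (7 * ((2 * m + a) + (2 * m + a) * (2 * m + a))) * (83 / 84) ^ (2 ^ m) \<le> (1 / 24 :: real)"
    using pullback_term_small by blast
  \<comment> \<open>Here 11424 = 24 * 476 brings \<open>(1 - eps / 476) ^ N\<close> below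
    \<open>exp (- 24)\<close>, and the factor \<open>2 ^ m0\<close> forces the exponent of
    \<open>N\<close> to be at least \<open>m0\<close>.\<close>
  define C :: real where "C = 11424 * 2 ^ m0"
  \<comment> \<open>\<open>N\<close> is the least power of two above \<open>C / eps\<close>, hence
    at most \<open>2 * C / eps\<close>. As a power of two it makes \<open>2 ^ k\<close> equal to
    \<open>2 ^ a\<close> times the square of \<open>N\<close>.\<close>
  define \<mu> where "\<mu> eps = (LEAST m. C / eps \<le> 2 ^ m)" for eps :: real
  define \<kappa> where "\<kappa> eps = 2 * \<mu> eps + a" for eps
  have C: "C \<ge> 11424" by (simp add: C_def)
  have main: "online_erasure_quadratic_tester t d eps (2 * C / eps) (quad_tester (\<kappa> eps) (2 ^ \<mu> eps) d)"
    if eps: "0 < eps" "eps < 1" and d: "d \<ge> \<kappa> eps + 7" for eps d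
  proof -
    let ?m = "\<mu> eps" and ?k = "\<kappa> eps"
    let ?N = "2 ^ ?m :: nat"
    have "\<exists>m. C / eps \<le> 2 ^ m"
      using real_arch_pow[of 2 "C / eps"] by (auto intro: less_imp_le)
    then have Nge: "C / eps \<le> 2 ^ ?m" unfolding \<mu>_def by (rule LeastI_ex)
    have "C \<le> C / eps" using eps C by (simp add: le_divide_eq mult_left_le)
    then have Cm: "C \<le> 2 ^ ?m" using Nge by linarith
    have "(2::real) ^ m0 \<le> 2 ^ ?m" using Cm unfolding C_def by (rule order.trans[rotated]) simp
    then have m0le: "m0 \<le> ?m" by simp
    have "?m \<noteq> 0" using Cm C by (intro notI) simp
    then obtain j where j: "?m = Suc j" by (cases ?m) auto
    have "\<not> C / eps \<le> 2 ^ j"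
      using not_less_Least[of j "\<lambda>m. C / eps \<le> 2 ^ m"] j unfolding \<mu>_def by simp
    then have Nle: "2 ^ ?m \<le> 2 * C / eps" unfolding j by simp
    have k1: "?k \<ge> 1" by (simp add: \<kappa>_def a_def)
    have "12 * t + 1 < 2 ^ a" unfolding a_def by (rule less_exp)
    then have "real (12 * t + 1) \<le> 2 ^ a" by (metis less_imp_le of_nat_le_iff of_nat_numeral of_nat_power)
    then have "real (12 * t + 1) * (2 ^ ?m)\<^sup>2 \<le> 2 ^ a * (2 ^ ?m)\<^sup>2" by (intro mult_right_mono) auto
    also have "\<dots> = 2 ^ ?k" by (simp add: \<kappa>_def power_add power_even_eq)
    \<comment> \<open>The first summand pays for the erasures; the second gives
      \<open>N \<le> 2 ^ k - 1\<close>, as required for the Chebyshev term.\<close>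
    finally have kN: "12 * real t * (2 ^ ?m)\<^sup>2 + (2 ^ ?m)\<^sup>2 \<le> 2 ^ ?k" by (simp add: distrib_right)
    have N1: "(2::real) ^ ?m \<ge> 2" using j by simp
    have NN: "(2 ^ ?m :: real) + 1 \<le> (2 ^ ?m)\<^sup>2"
    proof -
      have "(2 ^ ?m :: real) + 1 \<le> 2 * 2 ^ ?m" using N1 by linarith
      also have "\<dots> \<le> 2 ^ ?m * 2 ^ ?m" using N1 by (intro mult_right_mono) auto
      finally show ?thesis by (simp add: power2_eq_square)
    qed
    have "0 \<le> 12 * real t * (2 ^ ?m)\<^sup>2" by simp
    then have kM: "(2::real) ^ ?m \<le> 2 ^ ?k - 1" "12 * real t * (2 ^ ?m)\<^sup>2 \<le> 2 ^ ?k - 1"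
      using kN NN N1 by linarith+
    have M: "(2::real) ^ ?k - 1 > 0" using kM(1) N1 by linarith
    have epsN: "C \<le> eps * 2 ^ ?m" using Nge eps by (simp add: pos_divide_le_eq mult.commute)
    have T1: "136 / (eps * (2 ^ ?k - 1)) \<le> 1 / 12"
    proof -
      have "1632 \<le> eps * 2 ^ ?m" using epsN C by linarith
      also have "\<dots> \<le> eps * (2 ^ ?k - 1)" using kM(1) eps by (intro mult_left_mono) auto
      finally show ?thesis using eps M by (simp add: divide_le_eq)
    qed
    have T2: "7 * (2 ^ ?k - 1) / 2 ^ d \<le> (1 / 12 :: real)"
    proof -
      \<comment> \<open>The 7 extra dimensions suffice because 7/128 is below 1/12.\<close>
      have "(2::real) ^ (?k + 7) \<le> 2 ^ d" using d by (intro power_increasing) auto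
      then have "128 * (2::real) ^ ?k \<le> 2 ^ d" by (simp add: power_add)
      moreover have "12 * (7 * (x - 1)) \<le> y" if "128 * x \<le> y" "0 < x - 1" for x y :: real
        using that by simp
      ultimately have "12 * (7 * (2 ^ ?k - 1)) \<le> (2::real) ^ d"
        using M by blast
      then show ?thesis by (simp add: divide_le_eq)
    qed
    have T3: "t * real ?N ^ 2 / (2 ^ ?k - 1) \<le> 1 / 12"
      using kM(2) M by (simp add: divide_le_eq)
    have T4: "(1 - eps / 476) ^ ?N \<le> 1 / 24"
    proof -
      have "(1 - eps / 476) ^ ?N \<le> exp (- (eps / 476)) ^ ?N"
        using eps exp_ge_add_one_self[of "- (eps / 476)"] by (intro power_mono) auto
      also have "\<dots> = exp (- (eps * 2 ^ ?m / 476))"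
        by (simp flip: exp_of_nat_mult add: mult_ac)
      also have "\<dots> \<le> exp (- 24)" using epsN C by simp
      also have "\<dots> \<le> 1 / 24"
        using exp_ge_add_one_self[of 24] by (simp add: exp_minus inverse_eq_divide divide_le_eq)
      finally show ?thesis .
    qed
    have T5: "2 ^ (7 * (?k + ?k * ?k)) * (83 / 84) ^ ?N \<le> (1 / 24 :: real)"
      using m0[OF m0le] by (simp only: \<kappa>_def)
    show ?thesis
      unfolding online_erasure_quadratic_tester_def
    proof (intro conjI allI impI ballI)
      fix r assume r: "r \<in> set_pmf (quad_tester ?k ?N d)"
      obtain qs dec where qd: "r = (qs, dec)" by (cases r)
      show "case r of (qs, dec) \<Rightarrow> set qs \<subseteq> cube d \<and> real (length qs) \<le> 2 * C / eps"
        using set_quad_tester(1,2)[OF k1, of qs dec ?N d] r Nle by (simp add: qd)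
    next
      fix f A assume "quadratic d f"
      then show "accept_prob (quad_tester ?k ?N d) f A = 1" by (rule quad_tester_complete[OF k1])
    next
      fix f A assume "far_from_quadratic d eps f" "valid_adversary d t A"
      \<comment> \<open>Three terms of 1/12 and two of 1/24 add up to 1/3.\<close>
      from quad_tester_sound[OF k1 eps this, of ?N] T1 T2 T3 T4 T5
      show "2 / 3 \<le> 1 - accept_prob (quad_tester ?k ?N d) f A" by linarith
    qed
  qed
  show ?thesis
    by (rule exI[of _ "2 * C"], rule exI[of _ "\<lambda>eps. \<kappa> eps + 7"],
        rule exI[of _ "\<lambda>eps d. quad_tester (\<kappa> eps) (2 ^ \<mu> eps) d"]) (use main in blast)
qed

end
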